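(* Let $q$ be a prime power. The $1$-dimensional affine group $AGL_1(q)$ (the group of transformations $t\mapsto at+b$ of the field $\mathbb F_q$, $a,b\in\mathbb F_q$, $a\neq 0$) is a chirality group if and only if $q=2^e$ with $e$ odd.
   Context: Let $\Delta=\langle r_0,r_1,r_2\mid r_0^2=r_1^2=r_2^2=1\rangle$ and let $\Delta^+$ be its index-$2$ subgroup of even-length words, generated by $\rho=r_1r_2$ and $\lambda=r_2r_0$. An (oriented) hypermap is a triple $(D,R,L)$ with $D$ a finite set and $R,L$ permutations of $D$ generating a group transitive on $D$ (the monodromy group). It is orientably regular if its automorphism group (permutations of $D$ commuting with $R$ and $L$) acts regularly on $D$; orientably regular hypermaps correspond (up to isomorphism) bijectively to normal subgroups $H$ of finite index in $\Delta^+$ (hypermap subgroups), the hypermap being $(\Delta^+/H,\rho,\lambda)$ acting by left multiplication. For $H\trianglelefteq\Delta^+$ put $H^r=r_2Hr_2$. The chirality group of the hypermap is $HH^r/H$ (isomorphic to $H/(H\cap H^r)$). A group $G$ is called a chirality group if $G$ is isomorphic to the chirality group of some orientably regular hypermap. *)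

theory Defs
  imports "HOL-Algebra.Coset" "HOL-Algebra.Bij" "HOL-Algebra.Generated_Groups"
    "HOL-Number_Theory.Prime_Powers"
begin

section \<open>The group \<open>\<Delta> = \<langle>r\<^sub>0, r\<^sub>1, r\<^sub>2 | r\<^sub>0\<^sup>2 = r\<^sub>1\<^sup>2 = r\<^sub>2\<^sup>2 = 1\<rangle>\<close>\<close>

text \<open>
  As the generators are involutions, inverse letters are not needed: \<open>\<Delta>\<close> is the set of
  words in the three generators, modulo the congruence generated by deleting two equal
  adjacent letters.
\<close>

datatype refl_gen = Gen0 | Gen1 | Gen2

inductive word_eq :: "refl_gen list \<Rightarrow> refl_gen list \<Rightarrow> bool" where
  word_eq_cancel: "word_eq (u @ a # a # v) (u @ v)"
| word_eq_refl: "word_eq u u"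
| word_eq_sym: "word_eq u v \<Longrightarrow> word_eq v u"
| word_eq_trans: "word_eq u v \<Longrightarrow> word_eq v w \<Longrightarrow> word_eq u w"

lemma word_eq_append_left: "word_eq u v \<Longrightarrow> word_eq (w @ u) (w @ v)"
proof (induction rule: word_eq.induct)
  case (word_eq_cancel u a v)
  then show ?case using word_eq.word_eq_cancel[of "w @ u" a v] by simp
qed (auto intro: word_eq.intros)

lemma word_eq_append_right: "word_eq u v \<Longrightarrow> word_eq (u @ w) (v @ w)"
proof (induction rule: word_eq.induct)
  case (word_eq_cancel u a v)
  then show ?case using word_eq.word_eq_cancel[of u a "v @ w"] by simp
qed (auto intro: word_eq.intros)

lemma word_eq_length_parity: "word_eq u v \<Longrightarrow> even (length u) \<longleftrightarrow> even (length v)"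
  by (induction rule: word_eq.induct) auto

quotient_type delta = "refl_gen list" / word_eq
  by (rule equivpI)
    (auto intro!: reflpI sympI transpI intro: word_eq.intros)

lift_definition delta_mult :: "delta \<Rightarrow> delta \<Rightarrow> delta" is "(@)"
  by (meson word_eq_append_left word_eq_append_right word_eq_trans)

lift_definition delta_one :: delta is "[]" .

lift_definition even_length :: "delta \<Rightarrow> bool" is "\<lambda>w. even (length w)"
  by (rule word_eq_length_parity)

definition Delta :: "delta monoid" (\<open>\<Delta>\<close>) where
  "\<Delta> = \<lparr>carrier = UNIV, monoid.mult = delta_mult, one = delta_one\<rparr>"

lift_definition r0 :: delta is "[Gen0]" .
lift_definition r1 :: delta is "[Gen1]" .
lift_definition r2 :: delta is "[Gen2]" .

definition DeltaPlus :: "delta monoid" (\<open>\<Delta>\<^sup>+\<close>) where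
  "\<Delta>\<^sup>+ = \<Delta>\<lparr>carrier := {g. even_length g}\<rparr>"

definition rho :: delta where "rho = r1 \<otimes>\<^bsub>\<Delta>\<^esub> r2"
definition lam :: delta where "lam = r2 \<otimes>\<^bsub>\<Delta>\<^esub> r0"

lemma delta_mult_assoc:
  "delta_mult (delta_mult x y) z = delta_mult x (delta_mult y z)"
  by transfer (simp add: word_eq_refl)

lemma delta_mult_one [simp]: "delta_mult delta_one x = x" "delta_mult x delta_one = x"
  by (transfer; simp add: word_eq_refl)+

lemma word_eq_rev_cancel: "word_eq (rev w @ w) []"
proof (induction w)
  case (Cons a w)
  have "word_eq (rev w @ a # a # w) (rev w @ w)" by (rule word_eq_cancel)
  with Cons show ?case by (auto intro: word_eq_trans)
qed (simp add: word_eq_refl)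

lemma delta_left_inverse: "\<exists>y. delta_mult y x = delta_one"
  by transfer (use word_eq_rev_cancel in blast)

lemma group_Delta: "group \<Delta>"
  by (rule groupI) (auto simp: Delta_def delta_mult_assoc delta_left_inverse)

lemma reflections_squared:
  "r0 \<otimes>\<^bsub>\<Delta>\<^esub> r0 = \<one>\<^bsub>\<Delta>\<^esub>" "r1 \<otimes>\<^bsub>\<Delta>\<^esub> r1 = \<one>\<^bsub>\<Delta>\<^esub>" "r2 \<otimes>\<^bsub>\<Delta>\<^esub> r2 = \<one>\<^bsub>\<Delta>\<^esub>"
  unfolding Delta_def
  by (simp_all, (transfer, use word_eq_cancel[of "[]" _ "[]"] in simp)+)

lemma even_length_mult: "even_length (delta_mult x y) \<longleftrightarrow> (even_length x \<longleftrightarrow> even_length y)"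
  by transfer auto

lemma even_length_one: "even_length delta_one"
  by transfer simp

lemma subgroup_even_length: "subgroup {g. even_length g} \<Delta>"
proof (rule group.subgroupI[OF group_Delta])
  fix a assume a: "a \<in> {g. even_length g}"
  have "inv\<^bsub>\<Delta>\<^esub> a \<otimes>\<^bsub>\<Delta>\<^esub> a = \<one>\<^bsub>\<Delta>\<^esub>"
    by (rule group.l_inv[OF group_Delta]) (simp add: Delta_def)
  with a show "inv\<^bsub>\<Delta>\<^esub> a \<in> {g. even_length g}"
    using even_length_mult[of "inv\<^bsub>\<Delta>\<^esub> a" a] even_length_one by (simp add: Delta_def)
qed (use even_length_one in \<open>auto simp: Delta_def even_length_mult\<close>)

lemma group_DeltaPlus: "group \<Delta>\<^sup>+"
  unfolding DeltaPlus_def by (rule group.subgroup_imp_group[OF group_Delta subgroup_even_length])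


lemma reflections_delta_mult:
  "delta_mult r0 (delta_mult r0 x) = x" "delta_mult r1 (delta_mult r1 x) = x"
  "delta_mult r2 (delta_mult r2 x) = x"
  "delta_mult r0 r0 = delta_one" "delta_mult r1 r1 = delta_one" "delta_mult r2 r2 = delta_one"
  using reflections_squared by (simp_all add: Delta_def flip: delta_mult_assoc)

lemma DeltaPlus_inverses:
  "inv\<^bsub>\<Delta>\<^sup>+\<^esub> rho = delta_mult r2 r1" "inv\<^bsub>\<Delta>\<^sup>+\<^esub> lam = delta_mult r0 r2"
proof -
  have e: "even_length rho" "even_length lam"
    "even_length (delta_mult r2 r1)" "even_length (delta_mult r0 r2)"
    by (simp_all add: rho_def lam_def Delta_def) (transfer; simp)+
  show "inv\<^bsub>\<Delta>\<^sup>+\<^esub> rho = delta_mult r2 r1" "inv\<^bsub>\<Delta>\<^sup>+\<^esub> lam = delta_mult r0 r2"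
    by (rule group.inv_equality[OF group_DeltaPlus];
        use e in \<open>simp add: DeltaPlus_def Delta_def rho_def lam_def delta_mult_assoc
          reflections_delta_mult\<close>)+
qed

lemma abs_delta_letter: "abs_delta [a] \<in> {r0, r1, r2}"
  by (cases a) (simp_all add: r0_def r1_def r2_def)

lemma abs_delta_append: "abs_delta (u @ v) = delta_mult (abs_delta u) (abs_delta v)"
  by (simp add: delta_mult.abs_eq)

lemma DeltaPlus_generated: "carrier \<Delta>\<^sup>+ = generate \<Delta>\<^sup>+ {rho, lam}"
proof
  let ?S = "generate \<Delta>\<^sup>+ {rho, lam}"
  have mult: "delta_mult x y \<in> ?S" if "x \<in> ?S" "y \<in> ?S" for x y
    using generate.eng[OF that] by (simp add: DeltaPlus_def Delta_def)
  have one: "delta_one \<in> ?S"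
    using generate.one[of "\<Delta>\<^sup>+" "{rho, lam}"] by (simp add: DeltaPlus_def Delta_def)
  have gens: "delta_mult r1 r2 \<in> ?S" "delta_mult r2 r0 \<in> ?S"
    "delta_mult r2 r1 \<in> ?S" "delta_mult r0 r2 \<in> ?S"
    using generate.incl[of rho "{rho, lam}" "\<Delta>\<^sup>+"] generate.incl[of lam "{rho, lam}" "\<Delta>\<^sup>+"]
      generate.inv[of rho "{rho, lam}" "\<Delta>\<^sup>+"] generate.inv[of lam "{rho, lam}" "\<Delta>\<^sup>+"]
    unfolding DeltaPlus_inverses by (simp_all add: rho_def lam_def Delta_def)
  have gens': "delta_mult r1 r0 \<in> ?S" "delta_mult r0 r1 \<in> ?S"
    using mult[OF gens(1,2)] mult[OF gens(4,3)]
    by (simp_all add: delta_mult_assoc reflections_delta_mult)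
  have pairs: "delta_mult x y \<in> ?S" if "x \<in> {r0, r1, r2}" "y \<in> {r0, r1, r2}" for x y
    using that gens gens' one by (auto simp: reflections_delta_mult)
  have "abs_delta w \<in> ?S" if "even (length w)" for w
    using that
  proof (induction w rule: induct_list012)
    case 1
    show ?case using one by (simp add: delta_one_def)
  next
    case (3 a b w)
    have "abs_delta (a # b # w) =
        delta_mult (delta_mult (abs_delta [a]) (abs_delta [b])) (abs_delta w)"
      by (simp flip: abs_delta_append)
    moreover have "delta_mult (abs_delta [a]) (abs_delta [b]) \<in> ?S"
      by (rule pairs[OF abs_delta_letter abs_delta_letter])
    moreover have "abs_delta w \<in> ?S"
      using 3 by simp
    ultimately show ?case by (simp only: mult)
  qed auto
  then have "x \<in> ?S" if "even_length x" for x
    using that by (induction x rule: delta.abs_induct) (simp add: even_length.abs_eq)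
  then show "carrier \<Delta>\<^sup>+ \<subseteq> ?S"
    by (subst DeltaPlus_def) auto
next
  have "even_length rho" "even_length lam"
    by (simp_all add: rho_def lam_def Delta_def) (transfer; simp)+
  then show "generate \<Delta>\<^sup>+ {rho, lam} \<subseteq> carrier \<Delta>\<^sup>+"
    by (intro group.generate_incl[OF group_DeltaPlus]) (auto simp: DeltaPlus_def)
qed


section \<open>Oriented hypermaps\<close>

record 'd hypermap =
  darts :: "'d set"
  rotR :: "'d \<Rightarrow> 'd"
  rotL :: "'d \<Rightarrow> 'd"

definition monodromy_group :: "'d hypermap \<Rightarrow> ('d \<Rightarrow> 'd) set" where
  "monodromy_group M = generate (BijGroup (darts M)) {rotR M, rotL M}"

definition oriented_hypermap :: "'d hypermap \<Rightarrow> bool" where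
  "oriented_hypermap M \<longleftrightarrow>
     finite (darts M) \<and> darts M \<noteq> {} \<and> rotR M \<in> Bij (darts M) \<and> rotL M \<in> Bij (darts M) \<and>
     (\<forall>x\<in>darts M. \<forall>y\<in>darts M. \<exists>g\<in>monodromy_group M. g x = y)"

definition hypermap_isomorphic :: "'d hypermap \<Rightarrow> 'e hypermap \<Rightarrow> bool" where
  "hypermap_isomorphic M N \<longleftrightarrow>
     (\<exists>f. bij_betw f (darts M) (darts N) \<and>
          (\<forall>x\<in>darts M. f (rotR M x) = rotR N (f x) \<and> f (rotL M x) = rotL N (f x)))"

definition hypermap_automorphisms :: "'d hypermap \<Rightarrow> ('d \<Rightarrow> 'd) set" where
  "hypermap_automorphisms M =
     {f \<in> Bij (darts M). \<forall>x\<in>darts M. f (rotR M x) = rotR M (f x) \<and> f (rotL M x) = rotL M (f x)}"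

definition orientably_regular :: "'d hypermap \<Rightarrow> bool" where
  "orientably_regular M \<longleftrightarrow> oriented_hypermap M \<and>
     (\<forall>x\<in>darts M. \<forall>y\<in>darts M. \<exists>!f. f \<in> hypermap_automorphisms M \<and> f x = y)"

text \<open>
  The hypermap \<open>(\<Delta>\<^sup>+/H, \<rho>, \<lambda>)\<close>. It is only used for normal \<open>H\<close>, so that left and right cosets
  agree and left multiplication acts on the library's coset space.
\<close>

definition coset_hypermap :: "delta set \<Rightarrow> delta set hypermap" where
  "coset_hypermap H =
     \<lparr>darts = carrier (\<Delta>\<^sup>+ Mod H),
      rotR = (\<lambda>C \<in> carrier (\<Delta>\<^sup>+ Mod H). rho <#\<^bsub>\<Delta>\<^sup>+\<^esub> C),
      rotL = (\<lambda>C \<in> carrier (\<Delta>\<^sup>+ Mod H). lam <#\<^bsub>\<Delta>\<^sup>+\<^esub> C)\<rparr>"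

definition hypermap_subgroup :: "'d hypermap \<Rightarrow> delta set \<Rightarrow> bool" where
  "hypermap_subgroup M H \<longleftrightarrow>
     H \<lhd> \<Delta>\<^sup>+ \<and> finite (carrier (\<Delta>\<^sup>+ Mod H)) \<and> hypermap_isomorphic M (coset_hypermap H)"


section \<open>Chirality groups\<close>

definition mirror_subgroup :: "delta set \<Rightarrow> delta set" where
  "mirror_subgroup H = (\<lambda>h. r2 \<otimes>\<^bsub>\<Delta>\<^esub> h \<otimes>\<^bsub>\<Delta>\<^esub> r2) ` H"

text \<open>The quotient \<open>HH\<^sup>r/H\<close>.\<close>

definition chirality_quotient :: "delta set \<Rightarrow> delta set monoid" where
  "chirality_quotient H = \<Delta>\<^sup>+\<lparr>carrier := H <#>\<^bsub>\<Delta>\<^sup>+\<^esub> mirror_subgroup H\<rparr> Mod H"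

text \<open>
  Every finite set is in bijection with a set of natural numbers, so letting the hypermap range
  over hypermaps with darts in \<^typ>\<open>nat\<close> covers all hypermaps up to isomorphism.
\<close>

definition is_chirality_group :: "('g, 'm) monoid_scheme \<Rightarrow> bool" where
  "is_chirality_group G \<longleftrightarrow>
     group G \<and>
     (\<exists>(M :: nat hypermap) H. orientably_regular M \<and> hypermap_subgroup M H \<and>
        G \<cong> chirality_quotient H)"


section \<open>The one-dimensional affine group\<close>

definition AGL1 :: "('a::field \<Rightarrow> 'a) monoid" where
  "AGL1 = \<lparr>carrier = {(\<lambda>t. a * t + b) | a b. a \<noteq> 0}, monoid.mult = (\<circ>), one = id\<rparr>"

lemma AGL1_I: "a \<noteq> 0 \<Longrightarrow> (\<lambda>t. a * t + b) \<in> carrier AGL1"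
  unfolding AGL1_def by fastforce

lemma group_AGL1: "group (AGL1 :: ('a::field \<Rightarrow> 'a) monoid)"
proof (rule groupI)
  fix f g :: "'a \<Rightarrow> 'a"
  assume "f \<in> carrier AGL1" "g \<in> carrier AGL1"
  then obtain a b c d where f: "f = (\<lambda>t. a * t + b)" "a \<noteq> 0" and g: "g = (\<lambda>t. c * t + d)" "c \<noteq> 0"
    by (auto simp: AGL1_def)
  have "f \<otimes>\<^bsub>AGL1\<^esub> g = (\<lambda>t. (a * c) * t + (a * d + b))"
    by (simp add: AGL1_def f g fun_eq_iff distrib_left mult.assoc add.assoc)
  then show "f \<otimes>\<^bsub>AGL1\<^esub> g \<in> carrier AGL1"
    using AGL1_I[of "a * c" "a * d + b"] f g by simp
next
  have "id = (\<lambda>t::'a. 1 * t + 0)" by (simp add: fun_eq_iff)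
  then show "\<one>\<^bsub>AGL1\<^esub> \<in> carrier (AGL1 :: ('a \<Rightarrow> 'a) monoid)"
    using AGL1_I[of "1::'a" 0] by (simp add: AGL1_def)
next
  fix f :: "'a \<Rightarrow> 'a"
  assume "f \<in> carrier AGL1"
  then obtain a b where f: "f = (\<lambda>t. a * t + b)" "a \<noteq> 0" by (auto simp: AGL1_def)
  define g where "g = (\<lambda>t. inverse a * t + (- (inverse a * b)))"
  have "g \<in> carrier AGL1"
    unfolding g_def using f by (intro AGL1_I) simp
  moreover have "g \<otimes>\<^bsub>AGL1\<^esub> f = \<one>\<^bsub>AGL1\<^esub>"
    using f by (simp add: AGL1_def g_def fun_eq_iff distrib_left flip: mult.assoc)
  ultimately show "\<exists>g\<in>carrier AGL1. g \<otimes>\<^bsub>AGL1\<^esub> f = \<one>\<^bsub>AGL1\<^esub>" by blast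
qed (simp_all add: AGL1_def comp_assoc)

end

theory Submission
  imports Defs "HOL-Algebra.Zassenhaus" "HOL-Algebra.Algebraic_Closure_Type"
    "HOL-Library.Numeral_Type" "HOL-Number_Theory.Cong"
begin

text \<open>
  Conjugation makes \<open>\<Delta>\<^sup>+\<close> act on \<open>HH\<^sup>r/H \<cong> AGL\<^sub>1(q)\<close>; here \<open>H\<close> acts trivially and \<open>H\<^sup>r\<close> by all
  inner automorphisms. An automorphism of \<open>AGL\<^sub>1(q)\<close> acts on the translations by a semilinear
  bijection \<open>f\<close> of the field, so \<open>f (a b) = \<mu> a * f b\<close> with \<open>\<mu>\<close> multiplicative. If \<open>l \<in> {2, 3}\<close>
  divides \<open>q - 1\<close>, then \<open>f 1 ^ ((q - 1) / l)\<close> together with the action of \<open>\<mu>\<close> on the \<open>l\<close>-th roots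
  of unity, which is trivial or inversion, is a homomorphism from \<open>\<Delta>\<^sup>+\<close> to a dihedral group. Any two
  elements of a dihedral group are simultaneously inverted by an automorphism, so a
  homomorphism to it that is trivial on \<open>H\<close> is trivial on \<open>H\<^sup>r\<close>. But \<open>H\<^sup>r\<close> realises every nonzero
  value of \<open>f 1\<close>, a contradiction. The prime powers with \<open>q - 1\<close> prime to 6 are the
  \<open>2\<^sup>e\<close> with \<open>e\<close> odd.

  Conversely, if \<open>H\<close> is the kernel of a homomorphism \<open>\<phi>\<close> from \<open>\<Delta>\<^sup>+\<close> to a finite permutation group,
  then \<open>HH\<^sup>r/H \<cong> \<phi>(H\<^sup>r)\<close>. For \<open>q = 2\<^sup>e > 2\<close> a suitable group is \<open>A\<Gamma>L\<^sub>1(q)\<close>, for \<open>q = 2\<close> an affine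
  group over \<open>\<int>/16\<close>.
\<close>

section \<open>The mirror automorphism of \<open>\<Delta>\<^sup>+\<close>\<close>

lemma DeltaPlus_simps [simp]:
  "x \<otimes>\<^bsub>\<Delta>\<^sup>+\<^esub> y = delta_mult x y" "\<one>\<^bsub>\<Delta>\<^sup>+\<^esub> = delta_one"
  "x \<in> carrier \<Delta>\<^sup>+ \<longleftrightarrow> even_length x"
  by (simp_all add: DeltaPlus_def Delta_def)

interpretation DP: group "\<Delta>\<^sup>+"
  by (rule group_DeltaPlus)

lemma even_length_gens [simp]: "even_length rho" "even_length lam"
  by (simp_all add: rho_def lam_def Delta_def) (transfer; simp)+

lemma even_length_r2: "\<not> even_length r2"
  by transfer simp

definition mirror :: "delta \<Rightarrow> delta" where
  "mirror x = delta_mult (delta_mult r2 x) r2"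

lemma mirror_subgroup_eq: "mirror_subgroup H = mirror ` H"
  by (simp add: mirror_subgroup_def mirror_def Delta_def)

lemma mirror_mirror [simp]: "mirror (mirror x) = x"
  by (simp add: mirror_def delta_mult_assoc reflections_delta_mult)

lemma even_length_mirror [simp]: "even_length (mirror x) \<longleftrightarrow> even_length x"
  by (simp add: mirror_def even_length_mult even_length_r2)

lemma mirror_mult: "mirror (delta_mult x y) = delta_mult (mirror x) (mirror y)"
  by (simp add: mirror_def delta_mult_assoc reflections_delta_mult)

lemma mirror_hom: "mirror \<in> hom \<Delta>\<^sup>+ \<Delta>\<^sup>+"
  by (rule homI) (simp_all add: mirror_mult)

text \<open>Conjugation by \<open>r2\<close> turns \<open>r1 r2\<close> into \<open>r2 r1\<close>
  and \<open>r2 r0\<close> into \<open>r0 r2\<close>. Chirality thus compares a word in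
  \<open>rho\<close>, \<open>lam\<close> with the same word in their inverses.\<close>

lemma mirror_gens: "mirror rho = inv\<^bsub>\<Delta>\<^sup>+\<^esub> rho" "mirror lam = inv\<^bsub>\<Delta>\<^sup>+\<^esub> lam"
  unfolding DeltaPlus_inverses
  by (simp_all add: mirror_def rho_def lam_def Delta_def delta_mult_assoc reflections_delta_mult)

lemma mirror_inv: "even_length x \<Longrightarrow> mirror (inv\<^bsub>\<Delta>\<^sup>+\<^esub> x) = inv\<^bsub>\<Delta>\<^sup>+\<^esub> mirror x"
  using group_hom.hom_inv[OF group_hom.intro[OF DP.group_axioms DP.group_axioms
        group_hom_axioms.intro[OF mirror_hom]], of x]
  by simp

text \<open>The identity is covered as the product of \<open>rho\<close> and its inverse.\<close>

lemma DeltaPlus_induct [consumes 1, case_names rho lam inv mult]: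
  assumes "even_length x"
    and "P rho" "P lam"
    and "\<And>x. even_length x \<Longrightarrow> P x \<Longrightarrow> P (inv\<^bsub>\<Delta>\<^sup>+\<^esub> x)"
    and "\<And>x y. even_length x \<Longrightarrow> even_length y \<Longrightarrow> P x \<Longrightarrow> P y \<Longrightarrow> P (delta_mult x y)"
  shows "P x"
proof -
  have g: "even_length x" if "x \<in> generate \<Delta>\<^sup>+ {rho, lam}" for x
    using that DeltaPlus_generated by (metis DeltaPlus_simps(3))
  have "x \<in> generate \<Delta>\<^sup>+ {rho, lam}"
    using assms(1) DeltaPlus_generated by (metis DeltaPlus_simps(3))
  then show ?thesis
  proof (induction rule: generate.induct)
    case one
    have "P (delta_mult rho (inv\<^bsub>\<Delta>\<^sup>+\<^esub> rho))"
      using DP.inv_closed[of rho] by (intro assms(5) assms(4) assms(2)) simp_all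
    then show ?case using DP.r_inv[of rho] by simp
  next
    case (eng x y)
    then show ?case using assms(5) g by simp
  qed (use assms in auto)
qed

section \<open>The universal property of \<open>\<Delta>\<^sup>+\<close>\<close>

text \<open>Total bijections under plain composition, in contrast to the extensional functions of
  \<open>BijGroup\<close>: equations between permutations become equations of functions.\<close>

definition perm_group :: "('x \<Rightarrow> 'x) monoid" where
  "perm_group = \<lparr>carrier = {f. bij f}, monoid.mult = (\<circ>), one = id\<rparr>"

lemma perm_group_simps [simp]:
  "f \<otimes>\<^bsub>perm_group\<^esub> g = f \<circ> g" "\<one>\<^bsub>perm_group\<^esub> = id"
  "f \<in> carrier perm_group \<longleftrightarrow> bij f"
  by (simp_all add: perm_group_def)

lemma group_perm_group: "group (perm_group :: ('x \<Rightarrow> 'x) monoid)"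
proof (rule groupI)
  fix f :: "'x \<Rightarrow> 'x"
  assume "f \<in> carrier perm_group"
  then show "\<exists>g\<in>carrier perm_group. g \<otimes>\<^bsub>perm_group\<^esub> f = \<one>\<^bsub>perm_group\<^esub>"
    by (intro bexI[of _ "inv_into UNIV f"]) (auto simp: bij_imp_bij_inv bij_is_inj)
qed (auto simp: bij_comp comp_assoc)

text \<open>A letter moves one copy by a permutation and the other by its inverse, hence is an
  involution. On the copy \<open>True\<close>, \<open>r1 r2\<close> acts as \<open>f\<close> and
  \<open>r2 r0\<close> as \<open>g\<close>.\<close>

primrec letter_act :: "('x \<Rightarrow> 'x) \<Rightarrow> ('x \<Rightarrow> 'x) \<Rightarrow> refl_gen \<Rightarrow> 'x \<times> bool \<Rightarrow> 'x \<times> bool" where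
  "letter_act f g Gen2 = (\<lambda>(t, s). (t, \<not> s))"
| "letter_act f g Gen1 = (\<lambda>(t, s). (if s then inv_into UNIV f t else f t, \<not> s))"
| "letter_act f g Gen0 = (\<lambda>(t, s). (if s then g t else inv_into UNIV g t, \<not> s))"

text \<open>Words act on two copies of the set, swapped by every letter; the even words fix the copies
  and act on the first one through \<open>rho \<mapsto> f\<close>, \<open>lam \<mapsto> g\<close>.\<close>

definition word_act :: "('x \<Rightarrow> 'x) \<Rightarrow> ('x \<Rightarrow> 'x) \<Rightarrow> refl_gen list \<Rightarrow> 'x \<times> bool \<Rightarrow> 'x \<times> bool" where
  "word_act f g w = foldr (letter_act f g) w"

lemma word_act_append: "word_act f g (u @ v) = word_act f g u \<circ> word_act f g v"
  by (simp add: word_act_def fun_eq_iff)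

lemma letter_act_involution:
  assumes "bij f" "bij g"
  shows "letter_act f g a (letter_act f g a p) = p"
  using assms by (cases a; cases p)
    (auto simp: bij_is_surj surj_f_inv_f bij_is_inj inv_f_f)

lemma word_act_cong:
  assumes "word_eq u v" "bij f" "bij g"
  shows "word_act f g u = word_act f g v"
  using assms(1)
proof (induction rule: word_eq.induct)
  case (word_eq_cancel u a v)
  have "word_act f g (a # a # v) = word_act f g v"
    by (simp add: word_act_def letter_act_involution assms fun_eq_iff)
  then show ?case by (simp add: word_act_append)
qed auto

lemma snd_word_act: "snd (word_act f g w p) = (if even (length w) then snd p else \<not> snd p)"
proof (induction w)
  case (Cons a w)
  have "snd (letter_act f g a r) = (\<not> snd r)" for r
    by (cases a; cases r) auto
  with Cons show ?case by (simp add: word_act_def)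
qed (simp add: word_act_def)

text \<open>\<open>\<Delta>\<^sup>+\<close> is free on \<open>rho\<close> and \<open>lam\<close>, so
  their images may be prescribed arbitrarily.\<close>

theorem DeltaPlus_universal:
  fixes f g :: "'x \<Rightarrow> 'x"
  assumes f: "bij f" and g: "bij g"
  shows "\<exists>\<phi>. \<phi> \<in> hom \<Delta>\<^sup>+ perm_group \<and> \<phi> rho = f \<and> \<phi> lam = g"
proof -
  \<comment> \<open>The chosen representative is immaterial, since cancelling equal adjacent letters
    does not change the action.\<close>
  define act where "act x = word_act f g (rep_delta x)" for x
  have act_abs: "act (abs_delta w) = word_act f g w" for w
    unfolding act_def
    by (rule word_act_cong[OF _ f g]) (metis Quotient3_delta Quotient3_def word_eq_refl)
  have act_mult: "act (delta_mult x y) = act x \<circ> act y" for x y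
    by (induction x rule: delta.abs_induct; induction y rule: delta.abs_induct)
      (simp add: delta_mult.abs_eq act_abs word_act_append)
  have snd_act: "snd (act x p) = snd p" if "even_length x" for x p
    using that by (induction x rule: delta.abs_induct) (simp add: act_abs even_length.abs_eq snd_word_act)
  define \<phi> where "\<phi> x t = fst (act x (t, True))" for x t
  have act_eq: "act x (t, True) = (\<phi> x t, True)" if "even_length x" for x t
    using snd_act[OF that, of "(t, True)"] by (metis \<phi>_def prod.collapse snd_conv)
  have comp: "\<phi> (delta_mult x y) = \<phi> x \<circ> \<phi> y" if "even_length x" "even_length y" for x y
    by (rule ext) (simp add: \<phi>_def[of "delta_mult x y"] act_mult act_eq that)
  have one: "\<phi> delta_one = id"
    by (rule ext) (simp add: \<phi>_def delta_one_def act_abs word_act_def)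
  have bij: "bij (\<phi> x)" if "even_length x" for x
  proof (rule o_bij[of "\<phi> (inv\<^bsub>\<Delta>\<^sup>+\<^esub> x)"])
    show "\<phi> (inv\<^bsub>\<Delta>\<^sup>+\<^esub> x) \<circ> \<phi> x = id" "\<phi> x \<circ> \<phi> (inv\<^bsub>\<Delta>\<^sup>+\<^esub> x) = id"
      using DP.inv_closed[of x] DP.l_inv[of x] DP.r_inv[of x] that comp one by (metis DeltaPlus_simps)+
  qed
  have "\<phi> \<in> hom \<Delta>\<^sup>+ perm_group"
    by (rule homI) (simp_all add: comp bij)
  moreover have "\<phi> rho = f" "\<phi> lam = g"
    by (simp_all add: fun_eq_iff \<phi>_def rho_def lam_def Delta_def r0_def r1_def r2_def
        delta_mult.abs_eq act_abs word_act_def)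
  ultimately show ?thesis by blast
qed

section \<open>Chirality groups of kernels\<close>

text \<open>Left multiplication on \<open>P\<close> gives the monodromy; right multiplications
  commute with it and are simply transitive. The numbering \<open>b\<close> transports this to
  natural numbers.\<close>

lemma regular_hypermap_of_group:
  fixes P :: "('p, 'm) monoid_scheme"
  assumes P: "group P" and fin: "finite (carrier P)"
    and p: "p \<in> hom \<Delta>\<^sup>+ P" and surj: "p ` carrier \<Delta>\<^sup>+ = carrier P"
  shows "\<exists>(M :: nat hypermap) b. orientably_regular M \<and> bij_betw b (darts M) (carrier P) \<and>
    (\<forall>i\<in>darts M. b (rotR M i) = p rho \<otimes>\<^bsub>P\<^esub> b i \<and> b (rotL M i) = p lam \<otimes>\<^bsub>P\<^esub> b i)"
proof -
  interpret P: group P by (rule P)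
  obtain b where b: "bij_betw b {0..<card (carrier P)} (carrier P)"
    using ex_bij_betw_nat_finite[OF fin] by blast
  define S where "S = {0..<card (carrier P)}"
  define b' where "b' = inv_into S b"
  have bS: "b i \<in> carrier P" if "i \<in> S" for i
    using b that by (auto simp: bij_betw_def S_def)
  have img: "b ` S = carrier P"
    using b by (simp add: bij_betw_def S_def)
  have b'S: "b' g \<in> S" and bb': "b (b' g) = g" if "g \<in> carrier P" for g
    using that unfolding b'_def img[symmetric] by (rule inv_into_into, rule f_inv_into_f)
  have b'b: "b' (b i) = i" if "i \<in> S" for i
    using b that unfolding b'_def S_def bij_betw_def by (auto intro: inv_into_f_f)
  have b_eq: "i = j" if "b i = b j" "i \<in> S" "j \<in> S" for i j
    using that b'b by metis
  define L where "L g = (\<lambda>i\<in>S. b' (g \<otimes>\<^bsub>P\<^esub> b i))" for g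
  define R where "R g = (\<lambda>i\<in>S. b' (b i \<otimes>\<^bsub>P\<^esub> g))" for g
  have LS: "L g i \<in> S" and bL: "b (L g i) = g \<otimes>\<^bsub>P\<^esub> b i" if "g \<in> carrier P" "i \<in> S" for g i
    using that bS b'S bb' by (auto simp: L_def)
  have RS: "R g i \<in> S" and bR: "b (R g i) = b i \<otimes>\<^bsub>P\<^esub> g" if "g \<in> carrier P" "i \<in> S" for g i
    using that bS b'S bb' by (auto simp: R_def)
  have LBij: "L g \<in> Bij S" if g: "g \<in> carrier P" for g
  proof -
    have "L g (L (inv\<^bsub>P\<^esub> g) i) = i" "L (inv\<^bsub>P\<^esub> g) (L g i) = i" if "i \<in> S" for i
      using that g LS bS by (intro b_eq; simp add: bL flip: P.m_assoc)+
    then have "bij_betw (L g) S S"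
      using LS g by (intro bij_betwI[of _ _ _ "L (inv\<^bsub>P\<^esub> g)"]) auto
    then show ?thesis by (simp add: Bij_def L_def)
  qed
  have RBij: "R g \<in> Bij S" if g: "g \<in> carrier P" for g
  proof -
    have "R g (R (inv\<^bsub>P\<^esub> g) i) = i" "R (inv\<^bsub>P\<^esub> g) (R g i) = i" if "i \<in> S" for i
      using that g RS bS by (intro b_eq; simp add: bR P.m_assoc)+
    then have "bij_betw (R g) S S"
      using RS g by (intro bij_betwI[of _ _ _ "R (inv\<^bsub>P\<^esub> g)"]) auto
    then show ?thesis by (simp add: Bij_def R_def)
  qed
  have p_in: "p x \<in> carrier P" if "even_length x" for x
    using p that by (auto simp: hom_def)
  have Lhom: "L \<in> hom P (BijGroup S)"
  proof (rule homI)
    fix g h assume gh: "g \<in> carrier P" "h \<in> carrier P"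
    have "L (g \<otimes>\<^bsub>P\<^esub> h) i = L g (L h i)" if "i \<in> S" for i
      using gh that LS bS by (intro b_eq) (simp_all add: bL P.m_assoc)
    then have "L (g \<otimes>\<^bsub>P\<^esub> h) = compose S (L g) (L h)"
      by (auto simp: compose_def L_def[of "g \<otimes>\<^bsub>P\<^esub> h"] fun_eq_iff)
    then show "L (g \<otimes>\<^bsub>P\<^esub> h) = L g \<otimes>\<^bsub>BijGroup S\<^esub> L h"
      using LBij gh by (simp add: BijGroup_def)
  qed (simp add: BijGroup_def LBij)
  have Lp: "L \<circ> p \<in> hom \<Delta>\<^sup>+ (BijGroup S)"
    using hom_compose[OF p Lhom] .
  define M where "M = \<lparr>darts = S, rotR = L (p rho), rotL = L (p lam)\<rparr>"
  have M_simps [simp]: "darts M = S" "rotR M = L (p rho)" "rotL M = L (p lam)"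
    by (simp_all add: M_def)
  have "group_hom \<Delta>\<^sup>+ (BijGroup S) (L \<circ> p)"
    by (intro group_hom.intro group_hom_axioms.intro group_DeltaPlus group_BijGroup Lp)
  \<comment> \<open>The image of a generated group is generated by the images, so the monodromy
    group is the whole left regular representation.\<close>
  from group_hom.generate_img[OF this, of "{rho, lam}"]
  have mono: "monodromy_group M = L ` carrier P"
    unfolding monodromy_group_def by (simp add: image_image[symmetric, of L p] surj flip: DeltaPlus_generated)
  have move: "L (b y \<otimes>\<^bsub>P\<^esub> inv\<^bsub>P\<^esub> b x) x = y" "b y \<otimes>\<^bsub>P\<^esub> inv\<^bsub>P\<^esub> b x \<in> carrier P"
    if "x \<in> S" "y \<in> S" for x y
    using that LS bS by (auto intro!: b_eq simp: bL P.m_assoc)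
  have moveR: "R (inv\<^bsub>P\<^esub> b x \<otimes>\<^bsub>P\<^esub> b y) x = y" "inv\<^bsub>P\<^esub> b x \<otimes>\<^bsub>P\<^esub> b y \<in> carrier P"
    if "x \<in> S" "y \<in> S" for x y
    using that RS bS by (auto intro!: b_eq simp: bR simp flip: P.m_assoc)
  have "S \<noteq> {}"
    using P.one_closed b'S by blast
  then have ori: "oriented_hypermap M"
    unfolding oriented_hypermap_def mono
    using move LBij p_in by (auto simp: S_def) (metis imageI)
  have Raut: "R g \<in> hypermap_automorphisms M" if g: "g \<in> carrier P" for g
  proof -
    have "R g (L h i) = L h (R g i)" if "i \<in> S" "h \<in> carrier P" for i h
      using g that LS RS bS by (intro b_eq) (simp_all add: bL bR P.m_assoc)
    then show ?thesis
      unfolding hypermap_automorphisms_def using RBij g p_in by simp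
  qed
  \<comment> \<open>Commutation with the generators extends to all of
    \<open>\<Delta>\<^sup>+\<close>. By transitivity, an automorphism is then determined by the
    image of one dart.\<close>
  have aut_comm: "f (L (p x) i) = L (p x) (f i)"
    if f: "f \<in> hypermap_automorphisms M" and "even_length x" "i \<in> S" for f x i
    using that(2,3)
  proof (induction x arbitrary: i rule: DeltaPlus_induct)
    case (inv x)
    have fS: "f i \<in> S" if "i \<in> S" for i
      using f that by (auto simp: hypermap_automorphisms_def Bij_def bij_betw_def)
    have pinv: "p (inv\<^bsub>\<Delta>\<^sup>+\<^esub> x) = inv\<^bsub>P\<^esub> p x"
      using inv(1) by (intro group_hom.hom_inv group_hom.intro group_hom_axioms.intro p P
          group_DeltaPlus) simp
    have LL: "L (p x) (L (inv\<^bsub>P\<^esub> p x) j) = j" "L (inv\<^bsub>P\<^esub> p x) (L (p x) j) = j" if "j \<in> S" for j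
      using that inv(1) LS bS p_in by (intro b_eq; simp add: bL flip: P.m_assoc)+
    have k: "L (inv\<^bsub>P\<^esub> p x) i \<in> S"
      using inv(1,3) LS p_in by simp
    show ?case
      using inv.IH[OF k] LL(1)[OF inv(3)] LL(2)[OF fS[OF k]] by (simp add: pinv)
  next
    case (mult x y)
    have "L (p (delta_mult x y)) j = L (p x) (L (p y) j)" if "j \<in> S" for j
    proof -
      have "p (delta_mult x y) = p x \<otimes>\<^bsub>P\<^esub> p y"
        using hom_mult[OF p, of x y] mult by simp
      then show ?thesis
        using that mult LS bS p_in by (intro b_eq) (simp_all add: bL P.m_assoc)
    qed
    moreover have "f i \<in> S"
      using f mult(5) by (auto simp: hypermap_automorphisms_def Bij_def bij_betw_def)
    ultimately show ?case
      using mult LS p_in by simp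
  qed (use f in \<open>auto simp: hypermap_automorphisms_def\<close>)
  have uniq: "f = f'"
    if f: "f \<in> hypermap_automorphisms M" and f': "f' \<in> hypermap_automorphisms M"
      and eq: "f x = f' x" and x: "x \<in> S" for f f' x
  proof (rule extensionalityI[of _ S])
    fix y assume y: "y \<in> S"
    obtain d where "even_length d" "p d = b y \<otimes>\<^bsub>P\<^esub> inv\<^bsub>P\<^esub> b x"
      using move(2)[OF x y] surj by (metis DeltaPlus_simps(3) imageE)
    then show "f y = f' y"
      using aut_comm[OF f _ x] aut_comm[OF f' _ x] move(1)[OF x y] eq by metis
  qed (use f f' in \<open>auto simp: hypermap_automorphisms_def Bij_def\<close>)
  have "orientably_regular M"
    unfolding orientably_regular_def
  proof (intro conjI ori ballI)
    fix x y assume "x \<in> darts M" "y \<in> darts M"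
    then have xy: "x \<in> S" "y \<in> S" by simp_all
    show "\<exists>!f. f \<in> hypermap_automorphisms M \<and> f x = y"
      using Raut[OF moveR(2)[OF xy]] moveR(1)[OF xy] uniq xy(1) by blast
  qed
  then show ?thesis
    using b p_in bL by (intro exI[of _ M] exI[of _ b]) (simp add: S_def)
qed

text \<open>By normality, left multiplication of a coset by \<open>x\<close> is multiplication by
  the class of \<open>x\<close> in the quotient group, so the hypermap of that group
  applies.\<close>

lemma hypermap_of_normal_subgroup:
  assumes H: "H \<lhd> \<Delta>\<^sup>+" and fin: "finite (carrier (\<Delta>\<^sup>+ Mod H))"
  shows "\<exists>M :: nat hypermap. orientably_regular M \<and> hypermap_subgroup M H"
proof -
  interpret H: normal H "\<Delta>\<^sup>+" by (rule H)
  let ?p = "\<lambda>x. H #>\<^bsub>\<Delta>\<^sup>+\<^esub> x"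
  have car: "?p ` carrier \<Delta>\<^sup>+ = carrier (\<Delta>\<^sup>+ Mod H)"
    by (auto simp: FactGroup_def RCOSETS_def)
  have left: "x <#\<^bsub>\<Delta>\<^sup>+\<^esub> C = ?p x \<otimes>\<^bsub>\<Delta>\<^sup>+ Mod H\<^esub> C"
    if x: "x \<in> carrier \<Delta>\<^sup>+" and C: "C \<in> carrier (\<Delta>\<^sup>+ Mod H)" for x C
  proof -
    obtain c where c: "c \<in> carrier \<Delta>\<^sup>+" "C = ?p c"
      using C unfolding car[symmetric] by blast
    have "x <#\<^bsub>\<Delta>\<^sup>+\<^esub> ?p c = x <#\<^bsub>\<Delta>\<^sup>+\<^esub> (c <#\<^bsub>\<Delta>\<^sup>+\<^esub> H)"
      using H.coset_eq c by simp
    also have "\<dots> = (x \<otimes>\<^bsub>\<Delta>\<^sup>+\<^esub> c) <#\<^bsub>\<Delta>\<^sup>+\<^esub> H"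
      using DP.lcos_m_assoc[OF H.subset x c(1)] .
    also have "\<dots> = ?p (x \<otimes>\<^bsub>\<Delta>\<^sup>+\<^esub> c)"
      using H.coset_eq DP.m_closed[OF x c(1)] by (metis)
    also have "\<dots> = ?p x <#>\<^bsub>\<Delta>\<^sup>+\<^esub> ?p c"
      using H.rcos_sum[OF x c(1)] by simp
    finally show ?thesis by (simp add: FactGroup_def c(2))
  qed
  obtain M :: "nat hypermap" and b where M: "orientably_regular M"
    "bij_betw b (darts M) (carrier (\<Delta>\<^sup>+ Mod H))"
    "\<forall>i\<in>darts M. b (rotR M i) = ?p rho \<otimes>\<^bsub>\<Delta>\<^sup>+ Mod H\<^esub> b i \<and> b (rotL M i) = ?p lam \<otimes>\<^bsub>\<Delta>\<^sup>+ Mod H\<^esub> b i"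
    using regular_hypermap_of_group[OF H.factorgroup_is_group fin H.r_coset_hom_Mod car] by blast
  have "b i \<in> carrier (\<Delta>\<^sup>+ Mod H)" if "i \<in> darts M" for i
    using M(2) that by (auto simp: bij_betw_def)
  then have "hypermap_isomorphic M (coset_hypermap H)"
    unfolding hypermap_isomorphic_def coset_hypermap_def using M left
    by (intro exI[of _ b]) simp
  then show ?thesis
    using M(1) H fin by (auto simp: hypermap_subgroup_def)
qed

text \<open>If \<open>H\<close> is the kernel of \<open>\<phi>\<close>, then the carrier below is \<open>\<phi>(H\<^sup>r)\<close>.\<close>

theorem chirality_group_of_hom:
  fixes \<phi> :: "delta \<Rightarrow> 'x::finite \<Rightarrow> 'x" and G :: "('g, 'm) monoid_scheme"
  assumes \<phi>: "\<phi> \<in> hom \<Delta>\<^sup>+ perm_group" and G: "group G"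
    and iso: "G \<cong> perm_group\<lparr>carrier := {\<phi> x | x. even_length x \<and> \<phi> (mirror x) = id}\<rparr>"
  shows "is_chirality_group G"
proof -
  interpret \<phi>: group_hom "\<Delta>\<^sup>+" perm_group \<phi>
    by (intro group_hom.intro group_hom_axioms.intro group_DeltaPlus group_perm_group \<phi>)
  define H where "H = kernel \<Delta>\<^sup>+ perm_group \<phi>"
  have H_iff: "x \<in> H \<longleftrightarrow> even_length x \<and> \<phi> x = id" for x
    by (simp add: H_def kernel_def)
  interpret H: normal H "\<Delta>\<^sup>+"
    unfolding H_def by (rule \<phi>.normal_kernel)
  \<comment> \<open>The quotient by the kernel embeds into the functions on a finite type.\<close>
  have fin: "finite (carrier (\<Delta>\<^sup>+ Mod H))"
    using \<phi>.FactGroup_inj_on[folded H_def] by (rule inj_on_finite[OF _ subset_UNIV]) simp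
  let ?N = "H <#>\<^bsub>\<Delta>\<^sup>+\<^esub> mirror_subgroup H"
  let ?S = "{\<phi> x | x. even_length x \<and> \<phi> (mirror x) = id}"
  have mH: "mirror_subgroup H = {x. even_length x \<and> \<phi> (mirror x) = id}"
    unfolding mirror_subgroup_eq set_eq_iff image_iff by (metis (mono_tags, lifting) H_iff
        even_length_mirror mem_Collect_eq mirror_mirror)
  have sub: "subgroup (mirror_subgroup H) \<Delta>\<^sup>+"
    unfolding mirror_subgroup_eq
    by (rule group_hom.subgroup_img_is_subgroup[where G = "\<Delta>\<^sup>+"])
      (intro group_hom.intro group_hom_axioms.intro group_DeltaPlus mirror_hom, rule H.subgroup_axioms)
  have N: "subgroup ?N \<Delta>\<^sup>+"
    by (rule DP.mult_norm_subgroup[OF H.normal_axioms sub])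
  \<comment> \<open>As \<open>\<phi>\<close> is trivial on \<open>H\<close>, the product
    \<open>?N\<close> has the same image as the mirrored subgroup alone.\<close>
  have img: "\<phi> ` ?N = ?S"
  proof -
    have "\<phi> (delta_mult h k) = \<phi> k" if "h \<in> H" "even_length k" for h k
      using that \<phi>.hom_mult[of h k] by (simp add: H_iff)
    then have "\<phi> ` ?N = \<phi> ` mirror_subgroup H"
      unfolding set_mult_def image_UN using H.one_closed mH by (auto simp: image_iff)
    then show ?thesis by (auto simp: mH)
  qed
  have ker: "kernel (\<Delta>\<^sup>+\<lparr>carrier := ?N\<rparr>) (perm_group\<lparr>carrier := ?S\<rparr>) \<phi> = H"
  proof -
    have "H \<subseteq> ?N"
    proof
      fix x assume "x \<in> H"
      then have "x \<otimes>\<^bsub>\<Delta>\<^sup>+\<^esub> \<one>\<^bsub>\<Delta>\<^sup>+\<^esub> \<in> ?N"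
        unfolding set_mult_def using subgroup.one_closed[OF sub] by blast
      then show "x \<in> ?N" by simp
    qed
    then show ?thesis
      using subgroup.subset[OF N] by (auto simp: kernel_def H_iff subset_iff)
  qed
  have "group_hom (\<Delta>\<^sup>+\<lparr>carrier := ?N\<rparr>) (perm_group\<lparr>carrier := ?S\<rparr>) \<phi>"
    using \<phi>.induced_group_hom[OF N] img by simp
  from group_hom.FactGroup_iso[OF this] have "chirality_quotient H \<cong> perm_group\<lparr>carrier := ?S\<rparr>"
    unfolding chirality_quotient_def ker using img by simp
  moreover have "group (chirality_quotient H)"
  proof -
    have "H \<lhd> \<Delta>\<^sup>+\<lparr>carrier := ?N\<rparr>"
      using group_hom.normal_kernel[OF \<open>group_hom (\<Delta>\<^sup>+\<lparr>carrier := ?N\<rparr>) _ _\<close>] by (simp only: ker)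
    then show ?thesis
      unfolding chirality_quotient_def by (rule normal.factorgroup_is_group)
  qed
  ultimately have "G \<cong> chirality_quotient H"
    using iso group.iso_sym iso_trans by blast
  then show ?thesis
    unfolding is_chirality_group_def
    using hypermap_of_normal_subgroup[OF H.normal_axioms fin] G by blast
qed

section \<open>The action on the chirality group\<close>

lemma DP_inv [simp]:
  assumes "even_length x"
  shows "even_length (inv\<^bsub>\<Delta>\<^sup>+\<^esub> x)"
    "delta_mult x (inv\<^bsub>\<Delta>\<^sup>+\<^esub> x) = delta_one" "delta_mult (inv\<^bsub>\<Delta>\<^sup>+\<^esub> x) x = delta_one"
    "delta_mult x (delta_mult (inv\<^bsub>\<Delta>\<^sup>+\<^esub> x) y) = y" "delta_mult (inv\<^bsub>\<Delta>\<^sup>+\<^esub> x) (delta_mult x y) = y"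
  using DP.inv_closed[of x] DP.r_inv[of x] DP.l_inv[of x] assms
  by (simp_all flip: delta_mult_assoc)

definition conj_by :: "delta \<Rightarrow> delta \<Rightarrow> delta" where
  "conj_by d x = delta_mult d (delta_mult x (inv\<^bsub>\<Delta>\<^sup>+\<^esub> d))"

lemma even_length_conj_by [simp]:
  "even_length d \<Longrightarrow> even_length (conj_by d x) \<longleftrightarrow> even_length x"
  by (simp add: conj_by_def even_length_mult)

lemma conj_by_mult:
  "even_length d \<Longrightarrow> conj_by d (delta_mult x y) = delta_mult (conj_by d x) (conj_by d y)"
  by (simp add: conj_by_def delta_mult_assoc)

lemma conj_by_comp:
  "even_length d \<Longrightarrow> even_length e \<Longrightarrow> conj_by (delta_mult d e) x = conj_by d (conj_by e x)"
  using DP.inv_mult_group[of d e] by (simp add: conj_by_def delta_mult_assoc)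

lemma conj_by_mirror:
  "even_length d \<Longrightarrow> conj_by d (mirror x) = mirror (conj_by (mirror d) x)"
  by (simp add: conj_by_def mirror_mult mirror_inv)

lemma conj_by_mem:
  assumes "H \<lhd> \<Delta>\<^sup>+" "even_length d" "h \<in> H"
  shows "conj_by d h \<in> H"
  using normal.inv_op_closed2[OF assms(1), of d h] assms(2,3) by (simp add: conj_by_def delta_mult_assoc)

text \<open>An element of \<open>N = HH^r\<close> acts by the inner automorphism of its own class in
  \<open>N/H\<close>. That class is trivial for elements of \<open>H\<close>, and every class has a
  representative in \<open>H^r\<close>.\<close>

lemma chirality_group_action:
  fixes G :: "('g, 'm) monoid_scheme"
  assumes "is_chirality_group G"
  obtains H and \<alpha> :: "delta \<Rightarrow> 'g \<Rightarrow> 'g" where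
    "\<And>h. h \<in> H \<Longrightarrow> even_length h"
    "\<And>d. even_length d \<Longrightarrow> \<alpha> d \<in> hom G G"
    "\<And>d e g. even_length d \<Longrightarrow> even_length e \<Longrightarrow> g \<in> carrier G \<Longrightarrow>
      \<alpha> (delta_mult d e) g = \<alpha> d (\<alpha> e g)"
    "\<And>h g. h \<in> H \<Longrightarrow> g \<in> carrier G \<Longrightarrow> \<alpha> h g = g"
    "\<And>a. a \<in> carrier G \<Longrightarrow> \<exists>h\<in>H. \<forall>g\<in>carrier G.
      \<alpha> (mirror h) g = a \<otimes>\<^bsub>G\<^esub> g \<otimes>\<^bsub>G\<^esub> inv\<^bsub>G\<^esub> a"
proof -
  obtain H where G: "group G" and H: "H \<lhd> \<Delta>\<^sup>+" and iso: "G \<cong> chirality_quotient H"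
    using assms unfolding is_chirality_group_def hypermap_subgroup_def by blast
  interpret G: group G by (rule G)
  interpret H: normal H "\<Delta>\<^sup>+" by (rule H)
  have H_even: "even_length h" if "h \<in> H" for h
    using H.mem_carrier[OF that] by simp
  have sub: "subgroup (mirror_subgroup H) \<Delta>\<^sup>+"
    unfolding mirror_subgroup_eq
    by (rule group_hom.subgroup_img_is_subgroup[where G = "\<Delta>\<^sup>+"])
      (intro group_hom.intro group_hom_axioms.intro group_DeltaPlus mirror_hom, rule H.subgroup_axioms)
  define N where "N = H <#>\<^bsub>\<Delta>\<^sup>+\<^esub> mirror_subgroup H"
  have N: "subgroup N \<Delta>\<^sup>+"
    unfolding N_def by (rule DP.mult_norm_subgroup[OF H.normal_axioms sub])
  have N_iff: "x \<in> N \<longleftrightarrow> (\<exists>h\<in>H. \<exists>k\<in>H. x = delta_mult h (mirror k))" for x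
    unfolding N_def set_mult_def mirror_subgroup_eq
    by (simp only: UN_iff bex_simps DeltaPlus_simps singleton_iff)
  have N_even: "even_length x" if "x \<in> N" for x
    using subgroup.mem_carrier[OF N that] by simp
  have N_mult: "delta_mult x y \<in> N" if "x \<in> N" "y \<in> N" for x y
    using subgroup.m_closed[OF N that] by simp
  have H_N: "h \<in> N" if "h \<in> H" for h
    unfolding N_iff
  proof (intro bexI)
    show "h = delta_mult h (mirror delta_one)"
      by (simp add: mirror_def reflections_delta_mult)
  qed (use that H.one_closed in simp_all)
  have mH_N: "mirror h \<in> N" if "h \<in> H" for h
    unfolding N_iff
  proof (intro bexI)
    show "mirror h = delta_mult delta_one (mirror h)" by simp
  qed (use that H.one_closed in simp_all)
  \<comment> \<open>Conjugation passes through \<open>mirror\<close> at the cost of mirroring the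
    conjugator, so \<open>H^r\<close> is normal as well.\<close>
  have N_conj: "conj_by d x \<in> N" if x: "x \<in> N" and d: "even_length d" for d x
  proof -
    obtain h k where hk: "h \<in> H" "k \<in> H" "x = delta_mult h (mirror k)"
      using x unfolding N_iff by blast
    have "conj_by d x = delta_mult (conj_by d h) (mirror (conj_by (mirror d) k))"
      by (simp add: hk(3) conj_by_mult conj_by_mirror d)
    moreover have "conj_by d h \<in> H" "conj_by (mirror d) k \<in> H"
      using d hk by (simp_all add: conj_by_mem[OF H])
    ultimately show ?thesis unfolding N_iff by blast
  qed
  have HN: "H \<lhd> \<Delta>\<^sup>+\<lparr>carrier := N\<rparr>"
    using DP.normal_restrict_supergroup[OF N H] H_N by blast
  obtain i where i: "i \<in> iso (\<Delta>\<^sup>+\<lparr>carrier := N\<rparr> Mod H) G"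
    using G.iso_sym[OF iso] unfolding is_iso_def chirality_quotient_def N_def by blast
  define \<pi> where "\<pi> x = i (H #>\<^bsub>\<Delta>\<^sup>+\<^esub> x)" for x
  have "i \<circ> (\<lambda>x. H #>\<^bsub>\<Delta>\<^sup>+\<lparr>carrier := N\<rparr>\<^esub> x) \<in> hom (\<Delta>\<^sup>+\<lparr>carrier := N\<rparr>) G"
    using i by (intro hom_compose[OF normal.r_coset_hom_Mod[OF HN]]) (simp add: iso_def)
  then have \<pi>: "\<pi> \<in> hom (\<Delta>\<^sup>+\<lparr>carrier := N\<rparr>) G"
    by (simp add: \<pi>_def[abs_def] comp_def r_coset_def)
  have \<pi>_mult: "\<pi> (delta_mult x y) = \<pi> x \<otimes>\<^bsub>G\<^esub> \<pi> y" if "x \<in> N" "y \<in> N" for x y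
    using hom_mult[OF \<pi>, of x y] that by simp
  have \<pi>_in: "\<pi> x \<in> carrier G" if "x \<in> N" for x
    using hom_in_carrier[OF \<pi>, of x] that by simp
  have car: "carrier (\<Delta>\<^sup>+\<lparr>carrier := N\<rparr> Mod H) = (\<lambda>x. H #>\<^bsub>\<Delta>\<^sup>+\<^esub> x) ` N"
    by (auto simp: FactGroup_def RCOSETS_def r_coset_def)
  have \<pi>_H: "\<pi> h = \<one>\<^bsub>G\<^esub>" if h: "h \<in> H" for h
  proof -
    have "\<pi> (delta_mult h h) = \<pi> h"
      unfolding \<pi>_def using H.rcos_const[OF _ h] H.rcos_const[OF _ H.m_closed[OF h h]]
        group_DeltaPlus by simp
    then show ?thesis
      using \<pi>_mult[OF H_N H_N, OF h h] \<pi>_in[OF H_N[OF h]] by simp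
  qed
  have \<pi>_eq: "\<exists>h\<in>H. x = delta_mult h y" if "x \<in> N" "y \<in> N" "\<pi> x = \<pi> y" for x y
  proof -
    have "inj_on i ((\<lambda>x. H #>\<^bsub>\<Delta>\<^sup>+\<^esub> x) ` N)"
      using i by (simp add: iso_def bij_betw_def car)
    then have "H #>\<^bsub>\<Delta>\<^sup>+\<^esub> x = H #>\<^bsub>\<Delta>\<^sup>+\<^esub> y"
      using that by (auto simp: \<pi>_def inj_on_def)
    then have "x \<in> H #>\<^bsub>\<Delta>\<^sup>+\<^esub> y"
      using DP.rcos_self[OF _ H.subgroup_axioms, of x] N_even[OF that(1)] by simp
    then show ?thesis by (auto simp: r_coset_def)
  qed
  have \<pi>_surj: "\<exists>x\<in>N. \<pi> x = g" if "g \<in> carrier G" for g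
  proof -
    have "i ` ((\<lambda>x. H #>\<^bsub>\<Delta>\<^sup>+\<^esub> x) ` N) = carrier G"
      using i unfolding iso_def bij_betw_def car by blast
    then have "g \<in> i ` ((\<lambda>x. H #>\<^bsub>\<Delta>\<^sup>+\<^esub> x) ` N)"
      using that by simp
    then show ?thesis
      by (elim imageE) (auto simp: \<pi>_def)
  qed
  have \<pi>_surj': "\<exists>k\<in>H. \<pi> (mirror k) = g" if g: "g \<in> carrier G" for g
  proof -
    obtain h k where "h \<in> H" "k \<in> H" "\<pi> (delta_mult h (mirror k)) = g"
      using \<pi>_surj[OF g] by (auto simp: N_iff)
    then show ?thesis
      using \<pi>_mult[OF H_N mH_N] \<pi>_H \<pi>_in[OF mH_N] by auto
  qed
  \<comment> \<open>The choice is harmless: two preimages of \<open>g\<close> differ by a factor in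
    \<open>H\<close>, and its conjugates stay in \<open>H\<close>.\<close>
  define \<alpha> where "\<alpha> d g = \<pi> (conj_by d (SOME x. x \<in> N \<and> \<pi> x = g))" for d g
  have \<alpha>_eq: "\<alpha> d (\<pi> x) = \<pi> (conj_by d x)" if x: "x \<in> N" and d: "even_length d" for d x
  proof -
    define y where "y = (SOME y. y \<in> N \<and> \<pi> y = \<pi> x)"
    have y: "y \<in> N" "\<pi> y = \<pi> x"
      unfolding y_def using someI[of "\<lambda>y. y \<in> N \<and> \<pi> y = \<pi> x", OF conjI[OF x refl]] by simp_all
    obtain h where h: "h \<in> H" "y = delta_mult h x"
      using \<pi>_eq[OF y(1) x y(2)] by blast
    have "\<pi> (conj_by d y) = \<pi> (conj_by d h) \<otimes>\<^bsub>G\<^esub> \<pi> (conj_by d x)"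
      using h x d by (simp add: conj_by_mult \<pi>_mult N_conj H_N)
    also have "\<dots> = \<pi> (conj_by d x)"
      using \<pi>_H[OF conj_by_mem[OF H d h(1)]] \<pi>_in[OF N_conj[OF x d]] by simp
    finally show ?thesis by (simp add: \<alpha>_def y_def)
  qed
  have \<alpha>_hom: "\<alpha> d \<in> hom G G" if d: "even_length d" for d
  proof (rule homI)
    fix g h assume "g \<in> carrier G" "h \<in> carrier G"
    then obtain x y where "x \<in> N" "\<pi> x = g" "y \<in> N" "\<pi> y = h"
      using \<pi>_surj by meson
    then show "\<alpha> d g \<in> carrier G" "\<alpha> d (g \<otimes>\<^bsub>G\<^esub> h) = \<alpha> d g \<otimes>\<^bsub>G\<^esub> \<alpha> d h"
      using d \<alpha>_eq[of x d] \<alpha>_eq[of y d] \<alpha>_eq[of "delta_mult x y" d]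
      by (auto simp: \<pi>_in N_conj \<pi>_mult N_mult conj_by_mult)
  qed
  have \<alpha>_mult: "\<alpha> (delta_mult d e) g = \<alpha> d (\<alpha> e g)"
    if "even_length d" "even_length e" and g: "g \<in> carrier G" for d e g
    using \<pi>_surj[OF g] that by (auto simp: \<alpha>_eq even_length_mult conj_by_comp N_conj)
  have inner: "\<alpha> x g = \<pi> x \<otimes>\<^bsub>G\<^esub> g \<otimes>\<^bsub>G\<^esub> inv\<^bsub>G\<^esub> \<pi> x" if x: "x \<in> N" and g: "g \<in> carrier G" for x g
  proof -
    obtain y where y: "y \<in> N" "\<pi> y = g" using \<pi>_surj[OF g] by blast
    have "delta_mult (conj_by x y) x = delta_mult x y"
      using N_even[OF x] by (simp add: conj_by_def delta_mult_assoc)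
    then have "\<pi> (conj_by x y) \<otimes>\<^bsub>G\<^esub> \<pi> x = \<pi> x \<otimes>\<^bsub>G\<^esub> g"
      using \<pi>_mult[OF N_conj[OF y(1) N_even[OF x]] x] \<pi>_mult[OF x y(1)] y by simp
    moreover have "\<alpha> x g = \<pi> (conj_by x y)"
      using \<alpha>_eq[OF y(1) N_even[OF x]] y(2) by simp
    ultimately show ?thesis
      using G.inv_solve_right[of "\<pi> (conj_by x y)" "\<pi> x \<otimes>\<^bsub>G\<^esub> g" "\<pi> x"] \<pi>_in[OF x]
        \<pi>_in[OF N_conj[OF y(1) N_even[OF x]]] g by simp
  qed
  have \<alpha>_H: "\<alpha> h g = g" if "h \<in> H" "g \<in> carrier G" for h g
    using inner[OF H_N] that \<pi>_H by simp
  have \<alpha>_inner: "\<exists>h\<in>H. \<forall>g\<in>carrier G. \<alpha> (mirror h) g = a \<otimes>\<^bsub>G\<^esub> g \<otimes>\<^bsub>G\<^esub> inv\<^bsub>G\<^esub> a" if "a \<in> carrier G" for a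
    using \<pi>_surj'[OF that] inner[OF mH_N] by metis
  show thesis
  proof (rule that[of H \<alpha>])
  qed (fact H_even \<alpha>_hom \<alpha>_mult \<alpha>_H \<alpha>_inner)+
qed

text \<open>A pair \<open>(c, \<kappa>)\<close> as below is a homomorphism into a generalised dihedral group. Every two
  elements of such a group are simultaneously inverted by one of its automorphisms, so these
  homomorphisms cannot detect chirality.\<close>

lemma dihedral_reflexible:
  fixes c :: "delta \<Rightarrow> 'a::field" and \<kappa> :: "delta \<Rightarrow> bool"
  assumes nz: "\<And>d. even_length d \<Longrightarrow> c d \<noteq> 0"
    and c_mult: "\<And>d e. even_length d \<Longrightarrow> even_length e \<Longrightarrow>
      c (delta_mult d e) = c d * (if \<kappa> d then c e else inverse (c e))"
    and \<kappa>_mult: "\<And>d e. even_length d \<Longrightarrow> even_length e \<Longrightarrow> \<kappa> (delta_mult d e) = (\<kappa> d = \<kappa> e)"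
    and d: "even_length d" and "c d = 1" "\<kappa> d"
  shows "c (mirror d) = 1"
proof -
  have \<kappa>1: "\<kappa> delta_one"
    using \<kappa>_mult[of delta_one delta_one] by (simp add: even_length_one)
  have c1: "c delta_one = 1"
    using c_mult[of delta_one delta_one] \<kappa>1 nz[of delta_one] by (simp add: even_length_one)
  have \<kappa>_inv: "\<kappa> (inv\<^bsub>\<Delta>\<^sup>+\<^esub> x) = \<kappa> x" if "even_length x" for x
    using \<kappa>_mult[of x "inv\<^bsub>\<Delta>\<^sup>+\<^esub> x"] \<kappa>1 that by simp
  have c_inv: "c (inv\<^bsub>\<Delta>\<^sup>+\<^esub> x) = (if \<kappa> x then inverse (c x) else c x)" if "even_length x" for x
    using c_mult[of x "inv\<^bsub>\<Delta>\<^sup>+\<^esub> x"] c1 that nz[of x] nz[of "inv\<^bsub>\<Delta>\<^sup>+\<^esub> x"]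
    by (auto simp: field_simps split: if_splits)
  have \<kappa>_mirror: "\<kappa> (mirror x) = \<kappa> x" if "even_length x" for x
    using that by (induction x rule: DeltaPlus_induct)
      (simp_all add: mirror_gens mirror_mult mirror_inv \<kappa>_inv \<kappa>_mult)
  show ?thesis
  proof (cases "\<kappa> rho \<or> \<kappa> lam")
    \<comment> \<open>Both generators go to reflections, which equal their own inverses, so
      mirroring does not change \<open>c\<close>.\<close>
    case False
    have "c (mirror x) = c x" if "even_length x" for x
      using that by (induction x rule: DeltaPlus_induct)
        (use False in \<open>simp_all add: mirror_gens mirror_mult mirror_inv c_inv c_mult \<kappa>_mirror\<close>)
    then show ?thesis using assms by simp
  next
    case True
    \<comment> \<open>Mirroring is realised by the automorphism that inverts rotations and sends a
      reflection \<open>c\<close> to \<open>c0 / c\<close>. At most one generator is a reflection;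
      \<open>c0\<close> is its square, so that it is fixed.\<close>
    define c0 where "c0 = (if \<not> \<kappa> rho then c rho ^ 2 else c lam ^ 2)"
    have c0: "c0 \<noteq> 0" by (simp add: c0_def nz)
    have "c (mirror x) = (if \<kappa> x then inverse (c x) else c0 / c x)" if "even_length x" for x
      using that
    proof (induction x rule: DeltaPlus_induct)
      case rho
      then show ?case by (simp add: mirror_gens c_inv c0_def power2_eq_square nz)
    next
      case lam
      then show ?case using True by (auto simp: mirror_gens c_inv c0_def power2_eq_square nz)
    next
      case (inv x)
      then show ?case by (simp add: mirror_inv c_inv \<kappa>_mirror \<kappa>_inv nz c0)
    next
      case (mult x y)
      then show ?case
        using nz[of x] nz[of y] c0 by (auto simp: mirror_mult c_mult \<kappa>_mult \<kappa>_mirror field_simps)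
    qed
    then show ?thesis using assms by simp
  qed
qed

section \<open>Automorphisms of the affine group\<close>

definition scal :: "'a::field \<Rightarrow> 'a \<Rightarrow> 'a" where "scal a = (\<lambda>t. a * t)"
definition shift :: "'a::field \<Rightarrow> 'a \<Rightarrow> 'a" where "shift b = (\<lambda>t. t + b)"

lemma AGL1_simps [simp]: "f \<otimes>\<^bsub>AGL1\<^esub> g = f \<circ> g" "\<one>\<^bsub>AGL1\<^esub> = id"
  by (simp_all add: AGL1_def)

lemma AGL1_iff: "f \<in> carrier AGL1 \<longleftrightarrow> (\<exists>a b. a \<noteq> 0 \<and> f = (\<lambda>t. a * t + b))"
  by (auto simp: AGL1_def)

lemma scal_AGL1: "a \<noteq> 0 \<Longrightarrow> scal a \<in> carrier AGL1"
  and shift_AGL1: "shift b \<in> carrier AGL1"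
  using AGL1_I[of a 0] AGL1_I[of 1 b] by (simp_all add: scal_def shift_def)

lemma AGL1_comp: "f \<in> carrier AGL1 \<Longrightarrow> g \<in> carrier AGL1 \<Longrightarrow> f \<circ> g \<in> carrier AGL1"
  using monoid.m_closed[OF group.is_monoid[OF group_AGL1], of f g] by simp

lemma shift_inject [simp]: "shift b = shift c \<longleftrightarrow> b = c"
  by (metis add_left_cancel shift_def)

lemma scal_shift: "scal a \<circ> shift b = shift (a * b) \<circ> scal a"
  by (simp add: scal_def shift_def fun_eq_iff distrib_left)

text \<open>Translations are commutators, which is why automorphisms preserve them.\<close>

lemma AGL1_hom_shift:
  fixes \<alpha> :: "('a::field \<Rightarrow> 'a) \<Rightarrow> 'a \<Rightarrow> 'a"
  assumes \<alpha>: "\<alpha> \<in> hom AGL1 AGL1" and w: "w \<noteq> 0" "w \<noteq> (1::'a)"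
  shows "\<exists>c. \<alpha> (shift b) = shift c"
proof -
  have in_AGL: "\<alpha> f \<in> carrier AGL1" if "f \<in> carrier AGL1" for f
    using hom_in_carrier[OF \<alpha> that] .
  have comp: "\<alpha> (f \<circ> g) = \<alpha> f \<circ> \<alpha> g" if "f \<in> carrier AGL1" "g \<in> carrier AGL1" for f g
    using hom_mult[OF \<alpha> that] by simp
  \<comment> \<open>Chosen with \<open>w * b' - b' = b\<close>, which makes \<open>shift b\<close>
    the commutator of \<open>scal w\<close> and \<open>shift b'\<close>.\<close>
  define b' where "b' = b / (w - 1)"
  have "shift b \<circ> shift b' = shift (w * b')"
    using w by (simp add: shift_def fun_eq_iff b'_def field_simps)
  then have "shift b \<circ> (shift b' \<circ> scal w) = scal w \<circ> shift b'"
    by (simp add: scal_shift flip: comp_assoc)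
  then have *: "\<alpha> (shift b) \<circ> (\<alpha> (shift b') \<circ> \<alpha> (scal w)) = \<alpha> (scal w) \<circ> \<alpha> (shift b')"
    using comp[OF shift_AGL1 AGL1_comp[OF shift_AGL1 scal_AGL1[OF w(1)]], of b b']
      comp[OF shift_AGL1 scal_AGL1[OF w(1)], of b'] comp[OF scal_AGL1[OF w(1)] shift_AGL1, of b']
    by simp
  obtain a1 b1 a2 b2 a3 b3 where
    f: "\<alpha> (shift b) = (\<lambda>t. a1 * t + b1)" "\<alpha> (shift b') = (\<lambda>t. a2 * t + b2)"
      "\<alpha> (scal w) = (\<lambda>t. a3 * t + b3)" "a2 \<noteq> 0" "a3 \<noteq> 0"
    using in_AGL[OF shift_AGL1, of b] in_AGL[OF shift_AGL1, of b'] in_AGL[OF scal_AGL1[OF w(1)]]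
    by (auto simp: AGL1_iff)
  have eq: "a1 * (a2 * (a3 * t + b3) + b2) + b1 = a3 * (a2 * t + b2) + b3" for t
    using fun_cong[OF *, of t] by (simp add: f)
  \<comment> \<open>The difference of the values at 1 and 0 is the linear coefficient; comparing
    both sides gives \<open>a1 = 1\<close>.\<close>
  have "a1 * (a2 * a3) =
      (a1 * (a2 * (a3 * 1 + b3) + b2) + b1) - (a1 * (a2 * (a3 * 0 + b3) + b2) + b1)"
    by (simp add: algebra_simps)
  also have "\<dots> = a3 * a2"
    unfolding eq by (simp add: algebra_simps)
  finally have "a1 * (a2 * a3) = a3 * a2" .
  then have "a1 = 1" using f by simp
  then show ?thesis using f(1) by (auto simp: shift_def)
qed

text \<open>Conjugation by \<open>scal a\<close> multiplies translations by \<open>a\<close>, so the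
  linear part \<open>u\<close> of its image satisfies \<open>f (a * c) = u * f c\<close>. Taking
  \<open>c = b\<close> and \<open>c = 1\<close> eliminates \<open>u\<close>. The form is free of
  division because \<open>f 1\<close> may vanish for a mere homomorphism.\<close>

lemma AGL1_hom_semilinear:
  fixes \<alpha> :: "('a::field \<Rightarrow> 'a) \<Rightarrow> 'a \<Rightarrow> 'a"
  assumes \<alpha>: "\<alpha> \<in> hom AGL1 AGL1" and f: "\<And>b. \<alpha> (shift b) = shift (f b)"
  shows "f (a * b) * f 1 = f a * f b"
proof (cases "a = 0")
  case True
  have "shift 0 \<circ> shift 0 = shift (0 :: 'a)"
    by (simp add: shift_def fun_eq_iff)
  then have "shift (f 0) = shift (f 0) \<circ> shift (f 0)"
    using hom_mult[OF \<alpha> shift_AGL1 shift_AGL1, of 0 0] by (simp add: f)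
  from fun_cong[OF this, of 0] have "f 0 = 0"
    by (simp only: shift_def comp_apply add_0_left add_cancel_right_right)
  then show ?thesis using True by simp
next
  case False
  obtain u v where uv: "\<alpha> (scal a) = (\<lambda>t. u * t + v)"
    using hom_in_carrier[OF \<alpha> scal_AGL1[OF False]] by (auto simp: AGL1_iff)
  have "f (a * c) = u * f c" for c
  proof -
    have "\<alpha> (scal a) \<circ> \<alpha> (shift c) = \<alpha> (shift (a * c)) \<circ> \<alpha> (scal a)"
      using hom_mult[OF \<alpha> scal_AGL1[OF False] shift_AGL1, of c]
        hom_mult[OF \<alpha> shift_AGL1 scal_AGL1[OF False], of "a * c"] by (simp add: scal_shift)
    from fun_cong[OF this[unfolded f uv], of 0] show ?thesis
      by (simp add: shift_def algebra_simps)
  qed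
  from this[of b] this[of 1] have "f (a * b) = u * f b" "f a = u * f 1"
    by simp_all
  then show ?thesis by (simp only: mult_ac)
qed

text \<open>For these \<open>l\<close>, the powers of a nontrivial root are just 1, \<open>w\<close>
  and \<open>inverse w\<close>; hence an injective multiplicative map acts on the roots trivially or
  by inversion.\<close>

lemma power_eq_one_cases:
  fixes w y :: "'a::field"
  assumes "l = 2 \<or> l = (3::nat)" "w ^ l = 1" "w \<noteq> 1" "y ^ l = 1"
  shows "y = 1 \<or> y = w \<or> y = inverse w"
proof -
  consider "l = 2" | "l = 3" using assms(1) by blast
  then show ?thesis
  proof cases
    case 1
    then have "w = - 1" "y = 1 \<or> y = - 1"
      using assms by (simp_all add: power2_eq_1_iff)
    then show ?thesis by auto
  next
    case 2
    have "(w - 1) * (w^2 + w + 1) = w^3 - 1"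
      by (simp add: algebra_simps power2_eq_square power3_eq_cube)
    then have w2: "w^2 + w + 1 = 0" using assms 2 by simp
    have "(y - 1) * (y - w) * (y - w^2) = y^3 - (w^2 + w + 1) * y^2 + (w^2 + w + 1) * (w * y) - w^3"
      by (simp add: algebra_simps power2_eq_square power3_eq_cube)
    then have "(y - 1) * (y - w) * (y - w^2) = 0" using w2 assms 2 by simp
    moreover have "w^2 = inverse w"
      using assms(2) 2 by (intro inverse_unique[symmetric]) (simp add: power2_eq_square power3_eq_cube mult.assoc)
    ultimately show ?thesis by auto
  qed
qed

text \<open>The polynomial \<open>X^m - 1\<close> has at most \<open>m\<close> roots, fewer than
  there are nonzero elements.\<close>

lemma finite_field_exists_power_neq_one:
  assumes "0 < m" "m < card (UNIV :: 'a::finite_field set) - 1"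
  shows "\<exists>a::'a. a \<noteq> 0 \<and> a ^ m \<noteq> 1"
proof (rule ccontr)
  assume *: "\<not> ?thesis"
  let ?p = "monom 1 m - 1 :: 'a poly"
  have "coeff ?p m = 1" using assms by simp
  then have "?p \<noteq> 0" by force
  have "degree ?p \<le> m" by (rule degree_diff_le) (simp_all add: degree_monom_le)
  have "card (UNIV - {0 :: 'a}) \<le> card {x. poly ?p x = 0}"
    using * by (intro card_mono) (auto simp: poly_monom)
  also have "\<dots> \<le> degree ?p" by (rule card_poly_roots_bound) fact
  also have "\<dots> \<le> m" by fact
  finally show False using assms by (simp add: card_Diff_singleton)
qed

lemma finite_field_power_card_minus_one:
  fixes a :: "'a::finite_field"
  assumes "a \<noteq> 0"
  shows "a ^ (card (UNIV :: 'a set) - 1) = 1"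
proof -
  have "a * a ^ (card (UNIV :: 'a set) - 1) = a ^ card (UNIV :: 'a set)"
    by (subst power_eq_if[of a]) simp
  then show ?thesis
    using assms by (simp add: finite_field_power_card_eq_same)
qed

theorem not_chirality_group_AGL1:
  assumes l: "l = 2 \<or> l = (3::nat)" and dvd: "l dvd card (UNIV :: 'a::finite_field set) - 1"
  shows "\<not> is_chirality_group (AGL1 :: ('a \<Rightarrow> 'a) monoid)"
proof
  assume "is_chirality_group (AGL1 :: ('a \<Rightarrow> 'a) monoid)"
  from chirality_group_action[OF this] obtain H and \<alpha> :: "delta \<Rightarrow> ('a \<Rightarrow> 'a) \<Rightarrow> 'a \<Rightarrow> 'a" where
    H: "\<And>h. h \<in> H \<Longrightarrow> even_length h"
    and \<alpha>_hom: "\<And>d. even_length d \<Longrightarrow> \<alpha> d \<in> hom AGL1 AGL1"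
    and \<alpha>_mult: "\<And>d e g. even_length d \<Longrightarrow> even_length e \<Longrightarrow> g \<in> carrier AGL1 \<Longrightarrow>
      \<alpha> (delta_mult d e) g = \<alpha> d (\<alpha> e g)"
    and \<alpha>_H: "\<And>h g. h \<in> H \<Longrightarrow> g \<in> carrier AGL1 \<Longrightarrow> \<alpha> h g = g"
    and \<alpha>_mH: "\<And>a. a \<in> carrier AGL1 \<Longrightarrow> \<exists>h\<in>H. \<forall>g\<in>carrier AGL1.
      \<alpha> (mirror h) g = a \<otimes>\<^bsub>AGL1\<^esub> g \<otimes>\<^bsub>AGL1\<^esub> inv\<^bsub>AGL1\<^esub> a"
    by blast
  let ?q = "card (UNIV :: 'a set)"
  define m where "m = (?q - 1) div l"
  have "card {0, 1 :: 'a} \<le> ?q" by (intro card_mono) simp_all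
  then have q: "?q - 1 > 0" by simp
  have ml: "m * l = ?q - 1" using dvd by (simp add: m_def)
  then have "0 < m" "m < ?q - 1" using q l by (auto intro!: Nat.gr0I)
  then obtain a0 :: 'a where a0: "a0 \<noteq> 0" "a0 ^ m \<noteq> 1"
    using finite_field_exists_power_neq_one by blast
  \<comment> \<open>A nontrivial \<open>l\<close>-th root of unity.\<close>
  define w where "w = a0 ^ m"
  have root: "(a ^ m) ^ l = 1" if "a \<noteq> 0" for a :: 'a
    using finite_field_power_card_minus_one[OF that] by (simp add: ml flip: power_mult)
  have w: "w \<noteq> 0" "w \<noteq> 1" "w ^ l = 1"
    using a0 root by (simp_all add: w_def)
  define f where "f d b = (SOME c. \<alpha> d (shift b) = shift c)" for d b
  have f: "\<alpha> d (shift b) = shift (f d b)" if "even_length d" for d b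
    unfolding f_def using someI_ex[OF AGL1_hom_shift[OF \<alpha>_hom[OF that] w(1,2), of b]] .
  have f_mult: "f (delta_mult d e) b = f d (f e b)" if "even_length d" "even_length e" for d e b
    using \<alpha>_mult[OF that shift_AGL1, of b] that by (simp add: f even_length_mult)
  have f_H: "f h b = b" if "h \<in> H" for h b
    using \<alpha>_H[OF that shift_AGL1, of b] f[OF H[OF that], of b] by simp
  \<comment> \<open>Conjugation by \<open>scal a\<close> takes \<open>shift 1\<close> to
    \<open>shift a\<close>, and some mirrored element of \<open>H\<close> acts as this
    conjugation.\<close>
  have f_mH: "\<exists>h\<in>H. f (mirror h) 1 = a" if a: "a \<noteq> 0" for a
  proof -
    obtain h where h: "h \<in> H"
      "\<alpha> (mirror h) (shift 1) = scal a \<otimes>\<^bsub>AGL1\<^esub> shift 1 \<otimes>\<^bsub>AGL1\<^esub> inv\<^bsub>AGL1\<^esub> scal a"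
      using \<alpha>_mH[OF scal_AGL1[OF a]] shift_AGL1 by blast
    have "scal a \<circ> inv\<^bsub>AGL1\<^esub> scal a = id"
      using group.r_inv[OF group_AGL1 scal_AGL1[OF a]] by simp
    then have "\<alpha> (mirror h) (shift 1) = shift a"
      using h(2) by (simp add: scal_shift comp_assoc)
    then show ?thesis
      using f[of "mirror h" 1] H[OF h(1)] h(1) by (intro bexI[of _ h]) simp_all
  qed
  have f_inv: "f (inv\<^bsub>\<Delta>\<^sup>+\<^esub> d) (f d b) = f delta_one b" if "even_length d" for d b
    using f_mult[of "inv\<^bsub>\<Delta>\<^sup>+\<^esub> d" d b] that by simp
  have f_one: "f delta_one b = b" for b
  proof -
    obtain h where h: "h \<in> H" using f_mH[of 1] by auto
    show ?thesis
      using f_mult[OF even_length_one H[OF h], of b] f_H[OF h] by simp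
  qed
  have f_inj: "b = c" if "even_length d" "f d b = f d c" for d b c
    using f_inv[OF that(1)] f_one that(2) by metis
  have f_semi: "f d (a * b) * f d 1 = f d a * f d b" if "even_length d" for d a b
    by (rule AGL1_hom_semilinear[OF \<alpha>_hom f]) (rule that)+
  have f0: "f d 0 = 0" if "even_length d" for d
    using f_semi[OF that, of 0 0] f_inj[OF that, of 0 1] by auto
  have f1: "f d 1 \<noteq> 0" if "even_length d" for d
    using f_inj[OF that, of 1 0] f0[OF that] by auto
  \<comment> \<open>The multiplicative part of the semilinear map, normalised to fix 1.\<close>
  define \<mu> where "\<mu> d a = f d a / f d 1" for d a
  have \<mu>_times: "\<mu> d (a * b) = \<mu> d a * \<mu> d b" and f_\<mu>: "f d (a * b) = \<mu> d a * f d b"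
    if "even_length d" for d a b
    using f_semi[OF that, of a b] f1[OF that] by (simp_all add: \<mu>_def field_simps)
  have \<mu>1: "\<mu> d 1 = 1" if "even_length d" for d
    using f1[OF that] by (simp add: \<mu>_def)
  have \<mu>_inj: "a = b" if "even_length d" "\<mu> d a = \<mu> d b" for d a b
    using that f_inj[of d a b] f1[of d] by (simp add: \<mu>_def)
  have \<mu>_power: "\<mu> d (a ^ n) = \<mu> d a ^ n" if "even_length d" for d a n
    by (induction n) (simp_all add: \<mu>_times \<mu>1 that)
  have \<mu>_inverse: "\<mu> d (inverse a) = inverse (\<mu> d a)" if "even_length d" "a \<noteq> 0" for d a
    using \<mu>_times[OF that(1), of a "inverse a"] that by (simp add: \<mu>1 inverse_unique)
  have \<mu>_mult: "\<mu> (delta_mult d e) a = \<mu> d (\<mu> e a)" if "even_length d" "even_length e" for d e a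
  proof -
    have "f e a = \<mu> e a * f e 1" using f1[OF that(2)] by (simp add: \<mu>_def)
    then show ?thesis
      using f_\<mu>[OF that(1), of "\<mu> e a" "f e 1"] f1[of "delta_mult d e"] that
      by (simp add: \<mu>_def[of "delta_mult d e"] f_mult even_length_mult)
  qed
  have \<mu>_root: "\<mu> d y \<noteq> 1" "\<mu> d y ^ l = 1" if "even_length d" "y ^ l = 1" "y \<noteq> 1" for d y
    using \<mu>_inj[OF that(1), of y 1] \<mu>_power[OF that(1), of y l] \<mu>1[OF that(1)] that by auto
  \<comment> \<open>The \<open>m\<close>-th power lands in the \<open>l\<close>-th roots of unity,
    where \<open>\<mu> d\<close> is the identity or inversion; this yields the dihedral law for
    \<open>(c, \<kappa>)\<close>.\<close>
  define c where "c d = f d 1 ^ m" for d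
  define \<kappa> where "\<kappa> d \<longleftrightarrow> \<mu> d w = w" for d
  have \<mu>w: "\<mu> d w = (if \<kappa> d then w else inverse w)" if "even_length d" for d
    using power_eq_one_cases[OF l w(3,2) \<mu>_root(2)[OF that w(3,2)]] \<mu>_root(1)[OF that w(3,2)]
    by (auto simp: \<kappa>_def)
  have \<mu>_eq: "\<mu> d y = (if \<kappa> d then y else inverse y)" if "even_length d" "y ^ l = 1" for d y
    using power_eq_one_cases[OF l w(3,2) that(2)] \<mu>w[OF that(1)] \<mu>1[OF that(1)]
      \<mu>_inverse[OF that(1) w(1)] by auto
  have "c d = 1" if h: "h \<in> H" and d: "d = mirror h" for d h
    unfolding d
  proof (rule dihedral_reflexible[of c \<kappa>])
    fix d e assume de: "even_length d" "even_length e"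
    have "c (delta_mult d e) = (\<mu> d (f e 1) * f d 1) ^ m"
      using f_\<mu>[OF de(1), of "f e 1" 1] by (simp add: c_def f_mult de)
    also have "\<dots> = c d * \<mu> d (c e)"
      by (simp add: c_def power_mult_distrib \<mu>_power de)
    also have "\<mu> d (c e) = (if \<kappa> d then c e else inverse (c e))"
      using root[OF f1[OF de(2)]] by (intro \<mu>_eq de) (simp add: c_def)
    finally show "c (delta_mult d e) = c d * (if \<kappa> d then c e else inverse (c e))" .
    show "\<kappa> (delta_mult d e) = (\<kappa> d = \<kappa> e)"
    proof (cases "\<kappa> e")
      case True
      then show ?thesis by (simp add: \<kappa>_def \<mu>_mult de)
    next
      case False
      \<comment> \<open>This case cannot arise for \<open>l = 2\<close>, where \<open>w\<close> is
        its own inverse.\<close>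
      have "inverse w \<noteq> w" using \<mu>w[OF de(2)] False by (metis \<kappa>_def)
      moreover have "\<mu> (delta_mult d e) w = (if \<kappa> d then inverse w else w)"
        using \<mu>w[OF de(2)] False by (simp add: \<mu>_mult de \<mu>_inverse w(1) \<mu>w)
      ultimately show ?thesis
        using False by (simp add: \<kappa>_def[of "delta_mult d e"])
    qed
  next
    show "c h = 1" "\<kappa> h" "even_length h"
      using f_H[OF h] H[OF h] by (simp_all add: c_def \<kappa>_def \<mu>_def)
  qed (simp add: c_def f1)
  then have "a ^ m = 1" if "a \<noteq> 0" for a :: 'a
    using f_mH[OF that] by (auto simp: c_def)
  then show False using a0 by blast
qed

section \<open>Images of mirrored kernels\<close>

text \<open>For the kernel \<open>H\<close> of \<open>\<phi>\<close> this is the image of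
  \<open>H^r\<close>, a copy of the chirality group.\<close>

definition mirror_image :: "(delta \<Rightarrow> 'x \<Rightarrow> 'x) \<Rightarrow> ('x \<Rightarrow> 'x) set" where
  "mirror_image \<phi> = {\<phi> x | x. even_length x \<and> \<phi> (mirror x) = id}"

context
  fixes \<phi> :: "delta \<Rightarrow> 'x \<Rightarrow> 'x"
  assumes hom: "\<phi> \<in> hom \<Delta>\<^sup>+ perm_group"
begin

lemma perm_hom_mult: "even_length x \<Longrightarrow> even_length y \<Longrightarrow> \<phi> (delta_mult x y) = \<phi> x \<circ> \<phi> y"
  using hom_mult[OF hom, of x y] by simp

lemma perm_hom_bij: "even_length x \<Longrightarrow> bij (\<phi> x)"
  using hom_in_carrier[OF hom, of x] by simp

lemma perm_hom_one: "\<phi> delta_one = id"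
proof -
  have "\<phi> delta_one t = t" for t
  proof -
    obtain s where s: "t = \<phi> delta_one s"
      using perm_hom_bij[OF even_length_one] by (meson bij_pointE)
    show ?thesis
      unfolding s using perm_hom_mult[of delta_one delta_one] by (simp add: even_length_one fun_eq_iff)
  qed
  then show ?thesis by (simp add: fun_eq_iff)
qed

lemma perm_hom_inv_comp:
  assumes "even_length x"
  shows "\<phi> (inv\<^bsub>\<Delta>\<^sup>+\<^esub> x) \<circ> \<phi> x = id" "\<phi> x \<circ> \<phi> (inv\<^bsub>\<Delta>\<^sup>+\<^esub> x) = id"
  using perm_hom_mult[of x "inv\<^bsub>\<Delta>\<^sup>+\<^esub> x"] perm_hom_mult[of "inv\<^bsub>\<Delta>\<^sup>+\<^esub> x" x] assms perm_hom_one
  by simp_all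

lemma perm_hom_inv_eq: "even_length x \<Longrightarrow> \<phi> x \<circ> g = id \<Longrightarrow> \<phi> (inv\<^bsub>\<Delta>\<^sup>+\<^esub> x) = g"
  by (metis perm_hom_inv_comp(1) comp_assoc comp_id id_comp)

lemma mirror_image_id: "id \<in> mirror_image \<phi>"
  unfolding mirror_image_def
  by (intro CollectI exI[of _ delta_one])
    (simp add: even_length_one perm_hom_one mirror_def reflections_delta_mult)

lemma mirror_image_comp:
  assumes "f \<in> mirror_image \<phi>" "g \<in> mirror_image \<phi>"
  shows "f \<circ> g \<in> mirror_image \<phi>"
proof -
  obtain x y where "even_length x" "\<phi> (mirror x) = id" "f = \<phi> x" "even_length y" "\<phi> (mirror y) = id" "g = \<phi> y"
    using assms by (auto simp: mirror_image_def)
  then show ?thesis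
    unfolding mirror_image_def
    by (intro CollectI exI[of _ "delta_mult x y"])
      (simp add: even_length_mult mirror_mult perm_hom_mult)
qed

text \<open>Mirroring a conjugate of \<open>x\<close> conjugates \<open>mirror x\<close>, and a
  conjugate of the identity is trivial.\<close>

lemma mirror_image_conj:
  assumes "f \<in> mirror_image \<phi>" "even_length k"
  shows "\<phi> k \<circ> f \<circ> \<phi> (inv\<^bsub>\<Delta>\<^sup>+\<^esub> k) \<in> mirror_image \<phi>"
proof -
  obtain x where "even_length x" "\<phi> (mirror x) = id" "f = \<phi> x"
    using assms by (auto simp: mirror_image_def)
  then show ?thesis
    unfolding mirror_image_def using assms(2) perm_hom_inv_comp[of "mirror k"]
    by (intro CollectI exI[of _ "delta_mult (delta_mult k x) (inv\<^bsub>\<Delta>\<^sup>+\<^esub> k)"])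
      (simp add: even_length_mult mirror_mult perm_hom_mult mirror_inv)
qed

lemma mirror_image_inv:
  assumes "f \<in> mirror_image \<phi>" "f \<circ> g = id"
  shows "g \<in> mirror_image \<phi>"
proof -
  obtain x where x: "even_length x" "\<phi> (mirror x) = id" "f = \<phi> x"
    using assms by (auto simp: mirror_image_def)
  then show ?thesis
    unfolding mirror_image_def using assms(2) perm_hom_inv_eq[of x g] perm_hom_inv_eq[of "mirror x" id]
    by (intro CollectI exI[of _ "inv\<^bsub>\<Delta>\<^sup>+\<^esub> x"]) (simp add: mirror_inv)
qed

text \<open>Here \<open>x\<close> is \<open>lam rho lam\<inverse> z\<inverse>\<close>, and \<open>z\<close> will be a power of \<open>rho\<close>. The equations are arranged so
  that no inverse permutation has to be computed.\<close>

lemma perm_hom_relator: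
  assumes z: "even_length z" "mirror z = inv\<^bsub>\<Delta>\<^sup>+\<^esub> z"
  obtains x where "even_length x" "\<And>t. \<phi> x (\<phi> z (\<phi> lam t)) = \<phi> lam (\<phi> rho t)"
    "\<And>t. \<phi> rho (\<phi> lam (\<phi> (mirror x) t)) = \<phi> lam (\<phi> z t)"
proof -
  define x where "x = delta_mult lam (delta_mult rho (delta_mult (inv\<^bsub>\<Delta>\<^sup>+\<^esub> lam) (inv\<^bsub>\<Delta>\<^sup>+\<^esub> z)))"
  have x: "even_length x" using z by (simp add: x_def even_length_mult)
  have "delta_mult x (delta_mult z lam) = delta_mult lam rho"
    using z by (simp add: x_def delta_mult_assoc)
  then have "\<phi> x \<circ> (\<phi> z \<circ> \<phi> lam) = \<phi> lam \<circ> \<phi> rho"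
    using x z perm_hom_mult[of x "delta_mult z lam"] perm_hom_mult[of z lam] perm_hom_mult[of lam rho]
    by (simp add: even_length_mult)
  moreover have "delta_mult rho (delta_mult lam (mirror x)) = delta_mult lam z"
    using z DP.inv_inv[of rho] DP.inv_inv[of lam] DP.inv_inv[of z]
    by (simp add: x_def mirror_mult mirror_inv mirror_gens)
  then have "\<phi> rho \<circ> (\<phi> lam \<circ> \<phi> (mirror x)) = \<phi> lam \<circ> \<phi> z"
    using x z perm_hom_mult[of rho "delta_mult lam (mirror x)"] perm_hom_mult[of lam "mirror x"]
      perm_hom_mult[of lam z]
    by (simp add: even_length_mult)
  ultimately show ?thesis
    using that[OF x] by (simp add: fun_eq_iff)
qed

end

section \<open>The field with two elements\<close>

lemma double_eq_zero_mod16: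
  assumes "2 * (j :: 16) = 0"
  shows "j = 0 \<or> j = 8"
proof (cases j rule: bit0_cases)
  case (of_int z)
  have "(of_int (2 * z) :: 16) = 0" using assms of_int by simp
  then have "16 dvd 2 * z" by (simp only: of_int_eq_0_iff_char_dvd) simp
  then have "8 dvd z" by presburger
  then have "z = 0 \<or> z = 8" using of_int(2,3) by auto
  then show ?thesis using of_int(1) by auto
qed

lemma AGL1_field2:
  assumes "card (UNIV :: 'a::finite_field set) = 2"
  shows "carrier (AGL1 :: ('a \<Rightarrow> 'a) monoid) = {id, shift 1}" "(1 :: 'a) + 1 = 0"
proof -
  have U: "UNIV = {0, 1 :: 'a}"
    by (rule card_subset_eq[symmetric]) (simp_all add: assms)
  then have *: "a = 0 \<or> a = 1" for a :: 'a by blast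
  have "(1 :: 'a) + 1 \<noteq> 1" by (simp only: add_cancel_left_right one_neq_zero not_False_eq_True)
  then show "(1 :: 'a) + 1 = 0" using *[of "1 + 1"] by blast
  show "carrier (AGL1 :: ('a \<Rightarrow> 'a) monoid) = {id, shift 1}"
  proof
    show "carrier (AGL1 :: ('a \<Rightarrow> 'a) monoid) \<subseteq> {id, shift 1}"
    proof
      fix f :: "'a \<Rightarrow> 'a" assume "f \<in> carrier AGL1"
      then obtain a b where "a \<noteq> 0" "f = (\<lambda>t. a * t + b)" by (auto simp: AGL1_iff)
      then show "f \<in> {id, shift 1}"
        using *[of a] *[of b] by (auto simp: shift_def fun_eq_iff)
    qed
    have "shift 0 = (id :: 'a \<Rightarrow> 'a)" by (simp add: shift_def fun_eq_iff)
    then show "{id, shift 1} \<subseteq> carrier (AGL1 :: ('a \<Rightarrow> 'a) monoid)"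
      using shift_AGL1[of "0 :: 'a"] shift_AGL1[of "1 :: 'a"] by simp
  qed
qed

text \<open>The hypermap has the monodromy group of order 64 generated by \<open>t \<mapsto> t + 1\<close> and \<open>t \<mapsto> 3 t\<close>
  on \<open>\<int>/16\<close>. Its mirror image differs because \<open>3 \<noteq> 1/3\<close> modulo 16; as \<open>3 = 1/3\<close> modulo 8, the
  difference is only visible in \<open>t \<mapsto> t + 8\<close>.\<close>

lemma chirality_group_AGL1_2:
  assumes "card (UNIV :: 'a::finite_field set) = 2"
  shows "is_chirality_group (AGL1 :: ('a \<Rightarrow> 'a) monoid)"
proof -
  have n: "(32 :: 16) = 0" "(33 :: 16) = 1" "(96 :: 16) = 0" "(88 :: 16) = 8" by simp_all
  have "bij (\<lambda>t::16. t + 1)" "bij (\<lambda>t::16. 3 * t)"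
    by (rule o_bij[of "\<lambda>t. t - 1"], simp_all add: fun_eq_iff)
      (rule o_bij[of "\<lambda>t. 11 * t"], simp_all add: fun_eq_iff n)
  from DeltaPlus_universal[OF this] obtain \<phi> :: "delta \<Rightarrow> 16 \<Rightarrow> 16" where
    hom: "\<phi> \<in> hom \<Delta>\<^sup>+ perm_group" and \<phi>_rho: "\<phi> rho = (\<lambda>t. t + 1)" and \<phi>_lam: "\<phi> lam = (\<lambda>t. 3 * t)"
    by blast
  note mult = perm_hom_mult[OF hom]
  \<comment> \<open>A factor 2 in \<int>/16 expresses a congruence modulo 8: the linear parts of
    \<open>x\<close> and \<open>mirror x\<close> are mutually inverse and agree modulo 8, the
    translation parts are opposite modulo 8.\<close>
  have form: "\<exists>u j u' j'. \<phi> x = (\<lambda>t. u * t + j) \<and> \<phi> (mirror x) = (\<lambda>t. u' * t + j') \<and>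
      u * u' = 1 \<and> 2 * u = 2 * u' \<and> 2 * (j + j') = 0" if "even_length x" for x
    using that
  proof (induction x rule: DeltaPlus_induct)
    case rho
    have "\<phi> (inv\<^bsub>\<Delta>\<^sup>+\<^esub> rho) = (\<lambda>t. 1 * t + (-1))"
      by (rule perm_hom_inv_eq[OF hom]) (simp_all add: \<phi>_rho fun_eq_iff)
    then show ?case
      unfolding mirror_gens
      by (intro exI[of _ 1] exI[of _ "-1"] conjI) (auto simp: \<phi>_rho)
  next
    case lam
    have "\<phi> (inv\<^bsub>\<Delta>\<^sup>+\<^esub> lam) = (\<lambda>t. 11 * t)"
      by (rule perm_hom_inv_eq[OF hom]) (simp_all add: \<phi>_lam fun_eq_iff n)
    then show ?case
      unfolding mirror_gens
      by (intro exI[of _ 3] exI[of _ 0] exI[of _ 11] conjI) (auto simp: \<phi>_lam)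
  next
    case (inv x)
    then obtain u j u' j' where *: "\<phi> x = (\<lambda>t. u * t + j)" "\<phi> (mirror x) = (\<lambda>t. u' * t + j')"
      "u * u' = 1" "2 * u = 2 * u'" "2 * (j + j') = 0" by blast
    have cancel: "u * (u' * t + - (u' * s)) + s = t" "u' * (u * t + - (u * s)) + s = t" for s t
    proof -
      have "u * (u' * t + - (u' * s)) + s = (u * u') * (t - s) + s"
        "u' * (u * t + - (u * s)) + s = (u * u') * (t - s) + s"
        by (simp_all add: algebra_simps)
      then show "u * (u' * t + - (u' * s)) + s = t" "u' * (u * t + - (u * s)) + s = t"
        using *(3) by simp_all
    qed
    have "\<phi> (inv\<^bsub>\<Delta>\<^sup>+\<^esub> x) = (\<lambda>t. u' * t + (- (u' * j)))"
      by (rule perm_hom_inv_eq[OF hom inv(1)], rule ext) (simp only: *(1) comp_apply cancel id_apply)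
    moreover have "\<phi> (mirror (inv\<^bsub>\<Delta>\<^sup>+\<^esub> x)) = (\<lambda>t. u * t + (- (u * j')))"
      unfolding mirror_inv[OF inv(1)] using inv(1)
      by (intro perm_hom_inv_eq[OF hom] ext) (simp_all only: even_length_mirror *(2) comp_apply cancel id_apply)
    moreover have "2 * (- (u' * j) + - (u * j')) = 0"
    proof -
      have "2 * (- (u' * j) + - (u * j')) = - ((2 * u') * j + (2 * u) * j')"
        by (simp add: algebra_simps)
      also have "\<dots> = - (u * (2 * (j + j')))"
        unfolding *(4)[symmetric] by (simp add: algebra_simps)
      finally show ?thesis using *(5) by simp
    qed
    ultimately show ?case
      using * by (intro exI[of _ u'] exI[of _ "- (u' * j)"] exI[of _ u] exI[of _ "- (u * j')"])
        (simp add: mult.commute)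
  next
    case (mult x y)
    then obtain u j u' j' v k v' k' where
      *: "\<phi> x = (\<lambda>t. u * t + j)" "\<phi> (mirror x) = (\<lambda>t. u' * t + j')"
      "u * u' = 1" "2 * u = 2 * u'" "2 * (j + j') = 0"
      and **: "\<phi> y = (\<lambda>t. v * t + k)" "\<phi> (mirror y) = (\<lambda>t. v' * t + k')"
      "v * v' = 1" "2 * v = 2 * v'" "2 * (k + k') = 0" by metis
    have "\<phi> (delta_mult x y) = (\<lambda>t. (u * v) * t + (u * k + j))"
      using mult * ** by (simp add: perm_hom_mult[OF hom] fun_eq_iff algebra_simps)
    moreover have "\<phi> (mirror (delta_mult x y)) = (\<lambda>t. (u' * v') * t + (u' * k' + j'))"
      using mult * ** by (simp add: mirror_mult perm_hom_mult[OF hom] fun_eq_iff algebra_simps)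
    moreover have "2 * (u * k + j + (u' * k' + j')) = 0"
    proof -
      have "2 * (u * k + j + (u' * k' + j')) = (2 * u) * k + (2 * u') * k' + 2 * (j + j')"
        by (simp add: algebra_simps)
      also have "\<dots> = u * (2 * (k + k'))"
        unfolding *(4)[symmetric] *(5) by (simp add: algebra_simps)
      finally show ?thesis using **(5) by simp
    qed
    moreover have "(u * v) * (u' * v') = (u * u') * (v * v')" by (simp only: mult_ac)
    moreover have "2 * (u * v) = (2 * u) * v" "2 * (u' * v') = u' * (2 * v')" by (simp_all only: mult_ac)
    then have "2 * (u * v) = 2 * (u' * v')"
      unfolding *(4) **(4)[symmetric] by (simp only: mult_ac)
    ultimately show ?case
      using *(3) **(3)
      by (intro exI[of _ "u * v"] exI[of _ "u * k + j"] exI[of _ "u' * v'"] exI[of _ "u' * k' + j'"])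
        simp
  qed
  have image: "mirror_image \<phi> = {id, \<lambda>t. t + 8}"
  proof
    show "mirror_image \<phi> \<subseteq> {id, \<lambda>t. t + 8}"
    proof
      fix f assume "f \<in> mirror_image \<phi>"
      then obtain x where x: "even_length x" "\<phi> (mirror x) = id" "f = \<phi> x"
        by (auto simp: mirror_image_def)
      obtain u j u' j' where *: "\<phi> x = (\<lambda>t. u * t + j)" "\<phi> (mirror x) = (\<lambda>t. u' * t + j')"
        "u * u' = 1" "2 * (j + j') = 0" using form[OF x(1)] by blast
      have t: "u' * t + j' = t" for t using *(2) x(2) by (metis id_apply)
      have "j' = 0" "u' = 1" using t[of 0] t[of 1] by simp_all
      then have "u = 1" "j = 0 \<or> j = 8" using * double_eq_zero_mod16[of j] by simp_all
      then show "f \<in> {id, \<lambda>t. t + 8}" using x(3) *(1) by auto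
    qed
    \<comment> \<open>Under \<open>\<phi>\<close>, conjugating \<open>rho\<close> by
      \<open>lam\<close> gives \<open>t + 3\<close>, the action of \<open>rho^3\<close>; conjugating
      by the inverse of \<open>lam\<close> gives \<open>t + 11\<close>. The mirrored relator is
      therefore translation by 3 - 11 = 8.\<close>
    define z where "z = delta_mult rho (delta_mult rho rho)"
    have z: "even_length z" "mirror z = inv\<^bsub>\<Delta>\<^sup>+\<^esub> z" "\<phi> z = (\<lambda>t. t + 3)"
      using DP.inv_mult_group[of rho rho] DP.inv_mult_group[of rho "delta_mult rho rho"]
      by (simp_all add: z_def even_length_mult mirror_mult mirror_gens perm_hom_mult[OF hom] \<phi>_rho
          delta_mult_assoc fun_eq_iff)
    obtain x where x: "even_length x" "\<And>t. \<phi> x (\<phi> z (\<phi> lam t)) = \<phi> lam (\<phi> rho t)"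
      "\<And>t. \<phi> rho (\<phi> lam (\<phi> (mirror x) t)) = \<phi> lam (\<phi> z t)"
      using perm_hom_relator[OF hom z(1,2)] by blast
    \<comment> \<open>The argument is the preimage of \<open>s\<close> under
      \<open>t \<mapsto> 3 t + 3\<close>, since 11 inverts 3 modulo 16.\<close>
    have "\<phi> x s = s" for s
      using x(2)[of "11 * (s - 3)"] by (simp add: z(3) \<phi>_lam \<phi>_rho algebra_simps n)
    moreover have "\<phi> (mirror x) t = t + 8" for t
    proof -
      have "11 * (3 * \<phi> (mirror x) t + 1) = 11 * (3 * (t + 3))"
        using x(3)[of t] by (simp add: z(3) \<phi>_lam \<phi>_rho)
      then show ?thesis by (simp add: algebra_simps n)
    qed
    ultimately have "\<phi> x = id" "\<phi> (mirror x) = (\<lambda>t. t + 8)"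
      by (simp_all add: fun_eq_iff)
    then have "(\<lambda>t. t + 8) \<in> mirror_image \<phi>"
      unfolding mirror_image_def using x(1)
      by (intro CollectI exI[of _ "mirror x"]) simp
    with mirror_image_id[OF hom]
    show "{id, \<lambda>t. t + 8} \<subseteq> mirror_image \<phi>" by simp
  qed
  note AGL = AGL1_field2[OF assms]
  define F :: "('a \<Rightarrow> 'a) \<Rightarrow> 16 \<Rightarrow> 16" where "F f = (if f 0 = 0 then id else (\<lambda>t. t + 8))" for f
  have F: "F id = id" "F (shift 1) = (\<lambda>t. t + 8)" by (simp_all add: F_def shift_def)
  have ss: "shift 1 \<circ> shift 1 = (id :: 'a \<Rightarrow> 'a)"
    using AGL(2) by (simp add: shift_def fun_eq_iff add.assoc)
  have 88: "(\<lambda>t::16. t + 8) \<circ> (\<lambda>t. t + 8) = id"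
    by (simp add: fun_eq_iff)
  have ne: "(\<lambda>t::16. t + 8) \<noteq> id" "id \<noteq> (\<lambda>t::16. t + 8)"
    by (simp_all add: fun_eq_iff)
  have "F \<in> iso AGL1 (perm_group\<lparr>carrier := mirror_image \<phi>\<rparr>)"
  proof (rule isoI)
    show "F \<in> hom AGL1 (perm_group\<lparr>carrier := mirror_image \<phi>\<rparr>)"
      by (rule homI) (auto simp: AGL image F ss 88)
    show "bij_betw F (carrier AGL1) (carrier (perm_group\<lparr>carrier := mirror_image \<phi>\<rparr>))"
      by (auto simp: bij_betw_def inj_on_def AGL image F ne)
  qed
  then show ?thesis
    using chirality_group_of_hom[OF hom group_AGL1] by (auto simp: is_iso_def mirror_image_def)
qed

section \<open>Fields with \<open>2\<^sup>e\<close> elements, \<open>e > 1\<close> odd\<close>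

lemma finite_field_has_generator:
  "\<exists>g::'a::finite_field. g \<noteq> 0 \<and> (\<forall>a. a \<noteq> 0 \<longrightarrow> (\<exists>k::nat. a = g ^ k))"
proof -
  let ?R = "ring_of_type_algebra :: 'a ring"
  interpret R: field ?R by (rule field_from_type_algebra)
  have pow: "x [^]\<^bsub>?R\<^esub> k = x ^ k" for x :: 'a and k :: nat
    by (induction k) (simp_all add: nat_pow_def ring_of_type_algebra_def mult.commute)
  have car: "carrier (Multiplicative_Group.mult_of ?R) = {x. x \<noteq> 0}"
    by (auto simp: ring_of_type_algebra_def Multiplicative_Group.mult_of_def)
  have "finite (carrier ?R)" by (simp add: ring_of_type_algebra_def)
  from R.finite_field_mult_group_has_gen[OF this, unfolded car pow]
  obtain g :: 'a where g: "g \<noteq> 0" "{x. x \<noteq> 0} = {g ^ i | i::nat. i \<in> UNIV}"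
    by blast
  have "\<exists>k::nat. a = g ^ k" if "a \<noteq> 0" for a
    using that g(2) by blast
  with g(1) show ?thesis by blast
qed

text \<open>An inverse \<open>x\<close> of \<open>n\<close> modulo \<open>q - 1\<close> gives
  \<open>h = (h^n)^x\<close>, so \<open>h^n\<close> generates too.\<close>

lemma generator_power:
  fixes h :: "'a::finite_field"
  assumes h: "h \<noteq> 0" "\<And>a. a \<noteq> 0 \<Longrightarrow> \<exists>k::nat. a = h ^ k"
    and cop: "coprime n (card (UNIV :: 'a set) - 1)" and a: "a \<noteq> 0"
  shows "\<exists>k::nat. a = (h ^ n) ^ k"
proof -
  let ?m = "card (UNIV :: 'a set) - 1"
  obtain j where j: "a = h ^ j" using h(2)[OF a] by blast
  have one: "h ^ (?m * k) = 1" for k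
    using finite_field_power_card_minus_one[OF h(1)] by (simp add: power_mult)
  obtain x where "[n * x = Suc 0] (mod ?m)" using cong_solve_coprime_nat[of n ?m] cop by auto
  then obtain y z where "Suc 0 + z * ?m = n * x + y * ?m"
    unfolding cong_iff_lin_nat by blast
  from this[symmetric] have "n * x + ?m * y = 1 + ?m * z"
    by (simp add: mult.commute)
  then have "h ^ (n * x) * h ^ (?m * y) = h * h ^ (?m * z)"
    unfolding power_add[symmetric] power_Suc[symmetric] by simp
  then have "h ^ (n * x) = h"
    by (simp only: one mult.right_neutral)
  then have "(h ^ n) ^ (x * j) = h ^ j"
    unfolding power_mult[symmetric] mult.assoc[symmetric] by (simp only: power_mult)
  then show ?thesis using j by metis
qed

lemma char2_power2_power:
  fixes x y :: "'a::field"
  assumes "(1 :: 'a) + 1 = 0"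
  shows "(x + y) ^ (2 ^ n) = x ^ (2 ^ n) + y ^ (2 ^ n)"
proof (induction n)
  case (Suc n)
  have sq: "(a + b) ^ 2 = a ^ 2 + b ^ 2" for a b :: 'a
  proof -
    have "(a + b) ^ 2 = a ^ 2 + b ^ 2 + (1 + 1) * (a * b)"
      by (simp add: power2_eq_square algebra_simps)
    then show ?thesis using assms by simp
  qed
  have "(x + y) ^ (2 ^ Suc n) = ((x + y) ^ (2 ^ n)) ^ 2"
    by (simp add: power_mult[symmetric] mult.commute)
  also have "\<dots> = x ^ (2 ^ Suc n) + y ^ (2 ^ Suc n)"
    unfolding Suc.IH sq by (simp add: power_mult[symmetric] mult.commute)
  finally show ?case .
qed simp

text \<open>In the hypermap with \<open>rho \<mapsto> (t \<mapsto> g t)\<close>, \<open>lam \<mapsto> (t \<mapsto> t\<^sup>2 + 1)\<close>, modulo translations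
  \<open>lam\<close> acts on the generator \<open>g\<close> by squaring, in its mirror image by taking the
  square root. Hence modulo translations the mirror image of the relator \<open>lam rho lam\<inverse> rho\<^sup>-\<^sup>2\<close>
  is multiplication by \<open>g\<^bsup>3/2\<^esup>\<close>, again a generator because 3 does not divide \<open>q - 1\<close>.
  Taking \<open>g = h\<^sup>2\<close> avoids square roots.\<close>

lemma chirality_group_AGL1_power2:
  assumes card: "card (UNIV :: 'a::finite_field set) = 2 ^ e" and e: "odd e" "e \<noteq> 1"
  shows "is_chirality_group (AGL1 :: ('a \<Rightarrow> 'a) monoid)"
proof -

  \<comment> \<open>Arithmetic of the field and generators of its multiplicative group\<close>
  let ?q = "card (UNIV :: 'a set)"
  obtain r where e1: "e = Suc r" using e by (cases e) auto
  have e2: "e \<ge> 2" using e by (cases e) auto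
  have c2: "(1 :: 'a) + 1 = 0"
  proof -
    \<comment> \<open>The field order is even, so this power is 1; but raising to the field order is
      the identity, so it is also -1.\<close>
    have "(- 1 :: 'a) ^ ?q = 1" using e1 by (simp add: card neg_one_even_power even_power)
    then show ?thesis by (simp add: finite_field_power_card_eq_same eq_neg_iff_add_eq_0)
  qed
  have dbl: "x + x = 0" for x :: 'a
    using c2 by (metis mult_zero_right mult.right_neutral distrib_left)
  have dbl': "x + (x + y) = y" for x y :: 'a
    using dbl[of x] by (simp flip: add.assoc)
  note frob = char2_power2_power[OF c2]
  have sq: "(x + y)\<^sup>2 = x\<^sup>2 + y\<^sup>2" for x y :: 'a
    using frob[of x y 1] by simp
  have frob_q: "x ^ (2 ^ e) = x" for x :: 'a
    using finite_field_power_card_eq_same[of x] by (simp add: card)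
  have q4: "?q \<ge> 4"
    using power_increasing[OF e2, of "2 :: nat"] by (simp add: card)
  have cop2: "coprime 2 (?q - 1)"
    using e1 by (simp add: card)
  have "coprime 3 (?q - 1)"
  proof -
    \<comment> \<open>Odd powers of 2 are 2 modulo 3, so \<open>?q - 1\<close> is 1 modulo
      3.\<close>
    have "(2 :: nat) ^ e mod 3 = 2"
      using e(1) by (elim oddE) (simp add: power_mult mod_mult_right_eq[symmetric] power_mod[symmetric])
    then have "\<not> 3 dvd ?q - 1" unfolding card by presburger
    then show ?thesis by (intro prime_imp_coprime) simp_all
  qed
  with cop2 have cop6: "coprime 6 (?q - 1)"
    using coprime_mult_left_iff[of 2 3 "?q - 1"] by simp
  obtain h :: 'a where h: "h \<noteq> 0" "\<And>a. a \<noteq> 0 \<Longrightarrow> \<exists>k::nat. a = h ^ k"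
    using finite_field_has_generator by blast
  \<comment> \<open>\<open>g\<close> is the multiplier of \<open>rho\<close>. The mirrored relator
    has multiplier \<open>h^3\<close>, a square root of \<open>g^3\<close>; \<open>u\<close> is the
    multiplier of its square.\<close>
  define g where "g = h ^ 2"
  define u where "u = h ^ 6"
  have g: "\<exists>k::nat. a = g ^ k" if "a \<noteq> 0" for a
    unfolding g_def by (rule generator_power[OF h cop2 that])
  have u: "\<exists>k::nat. a = u ^ k" if "a \<noteq> 0" for a
    unfolding u_def by (rule generator_power[OF h cop6 that])
  have nz: "g \<noteq> 0" "u \<noteq> 0" using h(1) by (simp_all add: g_def u_def)
  obtain w :: 'a where w: "w \<noteq> 0" "w \<noteq> 1"
  proof -
    have "\<not> UNIV \<subseteq> {0, 1 :: 'a}"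
    proof
      assume "UNIV \<subseteq> {0, 1 :: 'a}"
      from card_mono[OF _ this] q4 show False by simp
    qed
    then show thesis using that by blast
  qed
  have ne1: "g \<noteq> 1" "u \<noteq> 1" using g[OF w(1)] u[OF w(1)] w(2) by auto
  define c where "c = g\<^sup>2 + 1"
  have c: "c \<noteq> 0"
  proof
    assume "c = 0"
    then have "(g + 1)\<^sup>2 = 0" by (simp add: c_def sq)
    then have "g + 1 = 0" by simp
    then show False using ne1(1) dbl'[of g 1] by simp
  qed

  \<comment> \<open>The homomorphism from \<open>\<Delta>\<^sup>+\<close> to semilinear maps\<close>
  have bij1: "bij (\<lambda>t::'a. g * t)"
    by (rule o_bij[of "\<lambda>t. inverse g * t"]) (simp_all add: fun_eq_iff nz)
  \<comment> \<open>As \<open>r = e - 1\<close>, raising to the power \<open>2 ^ r\<close> is the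
    square root.\<close>
  have inv2: "(t ^ 2 ^ r + 1)\<^sup>2 + 1 = t" "(t\<^sup>2 + 1) ^ 2 ^ r + 1 = t" for t :: 'a
  proof -
    have "(t ^ 2 ^ r)\<^sup>2 = t" "(t\<^sup>2) ^ 2 ^ r = t"
      using frob_q[of t] e1 by (metis power_Suc power_mult mult.commute)+
    then show "(t ^ 2 ^ r + 1)\<^sup>2 + 1 = t" "(t\<^sup>2 + 1) ^ 2 ^ r + 1 = t"
      by (simp_all add: sq frob add.assoc dbl)
  qed
  have bij2: "bij (\<lambda>t::'a. t\<^sup>2 + 1)"
    by (rule o_bij[of "\<lambda>t. t ^ 2 ^ r + 1"]) (simp_all add: fun_eq_iff inv2)
  obtain \<phi> :: "delta \<Rightarrow> 'a \<Rightarrow> 'a" where hom: "\<phi> \<in> hom \<Delta>\<^sup>+ perm_group"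
    and \<phi>_rho: "\<phi> rho = (\<lambda>t. g * t)" and \<phi>_lam: "\<phi> lam = (\<lambda>t. t\<^sup>2 + 1)"
    using DeltaPlus_universal[OF bij1 bij2] by blast
  note mult = perm_hom_mult[OF hom]

  \<comment> \<open>Frobenius exponents of a word and of its mirror image\<close>
  let ?semi = "\<lambda>f (i :: nat) (a :: 'a) b. a \<noteq> 0 \<and> f = (\<lambda>t. a * t ^ 2 ^ i + b)"
  have semi_comp: "?semi (f \<circ> f') (i + i') (a * a' ^ 2 ^ i) (a * b' ^ 2 ^ i + b)"
    if "?semi f i a b" "?semi f' i' a' b'" for f f' i i' a a' b b'
  proof
    have "(f \<circ> f') t = (a * a' ^ 2 ^ i) * t ^ 2 ^ (i + i') + (a * b' ^ 2 ^ i + b)" for t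
    proof -
      have "(f \<circ> f') t = a * ((a' * t ^ 2 ^ i') ^ 2 ^ i + b' ^ 2 ^ i) + b"
        using that by (simp only: comp_apply frob)
      also have "(a' * t ^ 2 ^ i') ^ 2 ^ i = a' ^ 2 ^ i * t ^ 2 ^ (i + i')"
        by (simp add: power_mult_distrib power_add mult.commute flip: power_mult)
      finally show ?thesis by (simp only: distrib_left mult.assoc add.assoc)
    qed
    then show "f \<circ> f' = (\<lambda>t. (a * a' ^ 2 ^ i) * t ^ 2 ^ (i + i') + (a * b' ^ 2 ^ i + b))"
      by blast
  qed (use that in simp)
  \<comment> \<open>The inverse first forms \<open>(t - b) / a\<close> and then undoes the Frobenius
    power by \<open>2 ^ j\<close>; signs vanish in characteristic 2.\<close>
  have semi_inv: "f \<circ> (\<lambda>t. inverse a ^ 2 ^ j * t ^ 2 ^ j + (b / a) ^ 2 ^ j) = id"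
    if f: "?semi f i a b" and ij: "\<forall>t::'a. t ^ 2 ^ (i + j) = t" for f i j a b
  proof
    fix t
    have "(inverse a ^ 2 ^ j * t ^ 2 ^ j + (b / a) ^ 2 ^ j) ^ 2 ^ i = (inverse a * t + b / a) ^ 2 ^ (i + j)"
      by (simp only: frob power_mult_distrib[symmetric] power_add mult.commute[of "2 ^ i"] power_mult)
    then have "a * (inverse a ^ 2 ^ j * t ^ 2 ^ j + (b / a) ^ 2 ^ j) ^ 2 ^ i + b
        = a * ((inverse a * t + b / a) ^ 2 ^ (i + j)) + b"
      by simp
    also have "\<dots> = t" using f ij by (simp add: distrib_left add.assoc dbl)
    finally show "(f \<circ> (\<lambda>t. inverse a ^ 2 ^ j * t ^ 2 ^ j + (b / a) ^ 2 ^ j)) t = id t"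
      using f by simp
  qed
  \<comment> \<open>The Frobenius exponents of \<open>x\<close> and \<open>mirror x\<close> cancel.
    If \<open>mirror x\<close> acts trivially, \<open>x\<close> thus acts without Frobenius twist,
    that is, affinely.\<close>
  have form: "\<exists>i j a b a' b'. (\<forall>t::'a. t ^ 2 ^ (i + j) = t) \<and> ?semi (\<phi> x) i a b \<and>
      ?semi (\<phi> (mirror x)) j a' b'" if "even_length x" for x
    using that
  proof (induction x rule: DeltaPlus_induct)
    case rho
    have "\<phi> (inv\<^bsub>\<Delta>\<^sup>+\<^esub> rho) = (\<lambda>t. inverse g * t)"
      by (rule perm_hom_inv_eq[OF hom]) (simp_all add: \<phi>_rho fun_eq_iff nz)
    then show ?case
      unfolding mirror_gens
      by (intro exI[of _ 0] exI[of _ g] exI[of _ "inverse g"] conjI) (auto simp: \<phi>_rho nz)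
  next
    case lam
    have "\<phi> (inv\<^bsub>\<Delta>\<^sup>+\<^esub> lam) = (\<lambda>t. t ^ 2 ^ r + 1)"
      by (rule perm_hom_inv_eq[OF hom]) (simp_all add: \<phi>_lam fun_eq_iff inv2)
    then show ?case
      unfolding mirror_gens using e1 frob_q
      by (intro exI[of _ 1] exI[of _ r] conjI) (auto simp: \<phi>_lam)
  next
    case (inv x)
    then obtain i j a b a' b' where *: "\<forall>t::'a. t ^ 2 ^ (i + j) = t" "?semi (\<phi> x) i a b"
      "?semi (\<phi> (mirror x)) j a' b'" by blast
    then have ij: "\<forall>t::'a. t ^ 2 ^ (j + i) = t" by (simp add: add.commute)
    have "?semi (\<phi> (inv\<^bsub>\<Delta>\<^sup>+\<^esub> x)) j (inverse a ^ 2 ^ j) ((b / a) ^ 2 ^ j)"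
      using perm_hom_inv_eq[OF hom inv(1) semi_inv[OF *(2,1)]] *(2) by simp
    moreover have "?semi (\<phi> (mirror (inv\<^bsub>\<Delta>\<^sup>+\<^esub> x))) i (inverse a' ^ 2 ^ i) ((b' / a') ^ 2 ^ i)"
      using perm_hom_inv_eq[OF hom _ semi_inv[OF *(3) ij]] inv(1) *(3) by (simp add: mirror_inv)
    ultimately show ?case using ij by blast
  next
    case (mult x y)
    then obtain i j a b a' b' k l d r d' r' where
      *: "\<forall>t::'a. t ^ 2 ^ (i + j) = t" "?semi (\<phi> x) i a b" "?semi (\<phi> (mirror x)) j a' b'"
      and **: "\<forall>t::'a. t ^ 2 ^ (k + l) = t" "?semi (\<phi> y) k d r" "?semi (\<phi> (mirror y)) l d' r'"
      by metis
    have "t ^ 2 ^ ((i + k) + (j + l)) = t" for t :: 'a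
    proof -
      have "(2 :: nat) ^ ((i + k) + (j + l)) = 2 ^ (i + j) * 2 ^ (k + l)"
        by (simp add: power_add)
      then show ?thesis using *(1) **(1) by (simp only: power_mult)
    qed
    moreover have "?semi (\<phi> (delta_mult x y)) (i + k) (a * d ^ 2 ^ i) (a * r ^ 2 ^ i + b)"
      unfolding perm_hom_mult[OF hom mult(1,2)] by (rule semi_comp[OF *(2) **(2)])
    moreover have e': "even_length (mirror x)" "even_length (mirror y)"
      using mult(1,2) by simp_all
    have "?semi (\<phi> (mirror (delta_mult x y))) (j + l) (a' * d' ^ 2 ^ j) (a' * r' ^ 2 ^ j + b')"
      unfolding mirror_mult perm_hom_mult[OF hom e']
      by (rule semi_comp[OF *(3) **(3)])
    ultimately show ?case by blast
  qed

  \<comment> \<open>The mirrored kernel maps onto the affine group\<close>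
  have "mirror_image \<phi> = carrier AGL1"
  proof
    show "mirror_image \<phi> \<subseteq> carrier AGL1"
    proof
      fix f assume "f \<in> mirror_image \<phi>"
      then obtain x where x: "even_length x" "\<phi> (mirror x) = id" "f = \<phi> x"
        by (auto simp: mirror_image_def)
      obtain i j a b a' b' where *: "\<forall>t::'a. t ^ 2 ^ (i + j) = t" "?semi (\<phi> x) i a b"
        "?semi (\<phi> (mirror x)) j a' b'" using form[OF x(1)] by blast
      have t: "a' * t ^ 2 ^ j + b' = t" for t using *(3) x(2) by (metis id_apply)
      have "b' = 0" "a' = 1" using t[of 0] t[of 1] by (simp_all add: power_0_left)
      then have j: "t ^ 2 ^ j = t" for t :: 'a using t by simp
      have "t ^ 2 ^ i = t" for t :: 'a
        using *(1) j[of "t ^ 2 ^ i"] by (simp add: power_add power_mult)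
      then show "f \<in> carrier AGL1" using *(2) x(3) by (auto simp: AGL1_iff)
    qed
    define z where "z = delta_mult rho rho"
    have z: "even_length z" "mirror z = inv\<^bsub>\<Delta>\<^sup>+\<^esub> z" "\<phi> z = (\<lambda>t. g\<^sup>2 * t)"
      using DP.inv_mult_group[of rho rho]
      by (simp_all add: z_def even_length_mult mirror_mult mirror_gens mult \<phi>_rho fun_eq_iff
          power2_eq_square mult.assoc)
    obtain x where x: "even_length x" "\<And>t. \<phi> x (\<phi> z (\<phi> lam t)) = \<phi> lam (\<phi> rho t)"
      "\<And>t. \<phi> rho (\<phi> lam (\<phi> (mirror x) t)) = \<phi> lam (\<phi> z t)"
      using perm_hom_relator[OF hom z(1,2)] by blast
    have \<phi>_x: "\<phi> x = shift c"
    proof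
      fix s
      obtain t where "s / g\<^sup>2 = t\<^sup>2 + 1"
        using bij2 by (meson bij_pointE)
      then have s: "s = g\<^sup>2 * (t\<^sup>2 + 1)" using nz by (simp add: field_simps)
      show "\<phi> x s = shift c s"
        using x(2)[of t] by (simp add: s z(3) \<phi>_lam \<phi>_rho shift_def c_def power_mult_distrib
            distrib_left add.assoc dbl')
    qed
    \<comment> \<open>Solving \<open>g * (y^2 + 1) = g^4 * t^2 + 1\<close> for \<open>y\<close>
      gives \<open>h^3 * t + k\<close>.\<close>
    define k where "k = inverse h + 1"
    have "\<phi> (mirror x) = (\<lambda>t. h ^ 3 * t + k)"
    proof
      fix t
      have "g * ((h ^ 3 * t + k)\<^sup>2 + 1) = (g\<^sup>2 * t)\<^sup>2 + 1"
        using h(1) by (simp add: sq k_def g_def power_mult_distrib distrib_left add.assoc dbl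
            power_inverse flip: power_mult power_add mult.assoc)
      then have "\<phi> rho (\<phi> lam (\<phi> (mirror x) t)) = \<phi> rho (\<phi> lam (h ^ 3 * t + k))"
        using x(3)[of t] by (simp add: z(3) \<phi>_lam \<phi>_rho)
      then show "\<phi> (mirror x) t = h ^ 3 * t + k"
        using perm_hom_bij[OF hom] by (simp add: bij_def inj_eq)
    qed
    \<comment> \<open>The relator \<open>x\<close> itself acts as the translation by
      \<open>c\<close>. Its square is trivial in characteristic 2, so the mirrored square belongs to
      the image.\<close>
    then have mx: "\<phi> (mirror (delta_mult x x)) = (\<lambda>t. u * t + (h ^ 3 * k + k))"
      using x(1) by (simp add: mirror_mult mult fun_eq_iff u_def distrib_left add.assoc
          flip: power_add mult.assoc)
    define n where "n = (\<lambda>t. u * t + (h ^ 3 * k + k))"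
    have n: "n \<in> mirror_image \<phi>"
    proof -
      have "\<phi> (delta_mult x x) = id"
        using x(1) by (simp add: mult \<phi>_x shift_def fun_eq_iff add.assoc dbl)
      then show ?thesis
        unfolding mirror_image_def using mx x(1)
        by (intro CollectI exI[of _ "mirror (delta_mult x x)"]) (simp add: n_def even_length_mult)
    qed
    \<comment> \<open>Conjugation by \<open>rho\<close> multiplies a translation by
      \<open>g\<close>; as \<open>g\<close> is a generator, all translations lie in the image of
      \<open>\<phi>\<close>.\<close>
    have shift_gc: "\<exists>y. even_length y \<and> \<phi> y = shift (g ^ i * c)" for i
    proof (induction i)
      case 0
      then show ?case using x(1) \<phi>_x by auto
    next
      case (Suc i)
      then obtain y where y: "even_length y" "\<phi> y = shift (g ^ i * c)" by blast
      have "\<phi> (inv\<^bsub>\<Delta>\<^sup>+\<^esub> rho) = scal (inverse g)"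
        by (rule perm_hom_inv_eq[OF hom]) (simp_all add: \<phi>_rho fun_eq_iff nz scal_def)
      then have "\<phi> (delta_mult rho (delta_mult y (inv\<^bsub>\<Delta>\<^sup>+\<^esub> rho))) = shift (g ^ Suc i * c)"
        using y nz by (simp add: mult even_length_mult \<phi>_rho scal_def shift_def fun_eq_iff
            distrib_left mult.assoc)
      then show ?case using y(1) by (intro exI conjI) (auto simp: even_length_mult)
    qed
    have shift_im: "\<exists>y. even_length y \<and> \<phi> y = shift b" if b: "b \<noteq> 0" for b
    proof -
      obtain i where "b / c = g ^ i" using g[of "b / c"] b c by auto
      then have "b = g ^ i * c" using c by (simp add: field_simps)
      then show ?thesis using shift_gc by blast
    qed
    have shift_mem: "shift b \<in> mirror_image \<phi>" for b
    proof (cases "b = 0")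
      case True
      then show ?thesis
        using mirror_image_id[OF hom] by (simp add: shift_def id_def)
    next
      case False
      \<comment> \<open>The commutator of \<open>shift d\<close> with \<open>n\<close> is
        \<open>shift ((1 - u) * d)\<close>, which this choice makes \<open>shift b\<close>.\<close>
      define d where "d = b / (1 - u)"
      have d: "(1 - u) * d = b" using ne1 by (simp add: d_def)
      then have "d \<noteq> 0" "d - u * d = b" using False by (auto simp: left_diff_distrib)
      obtain y where y: "even_length y" "\<phi> y = shift d" using shift_im[OF \<open>d \<noteq> 0\<close>] by blast
      have "\<phi> (inv\<^bsub>\<Delta>\<^sup>+\<^esub> y) = (\<lambda>t. t - d)"
        using y by (intro perm_hom_inv_eq[OF hom]) (simp_all add: shift_def fun_eq_iff)
      then have "(shift d \<circ> n \<circ> (\<lambda>t. t - d)) \<in> mirror_image \<phi>"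
        using mirror_image_conj[OF hom n y(1)] y(2) by simp
      moreover have "(\<lambda>t. (t - (h ^ 3 * k + k)) / u) \<in> mirror_image \<phi>"
        using nz by (intro mirror_image_inv[OF hom n]) (simp add: n_def fun_eq_iff)
      ultimately have "(shift d \<circ> n \<circ> (\<lambda>t. t - d)) \<circ> (\<lambda>t. (t - (h ^ 3 * k + k)) / u) \<in> mirror_image \<phi>"
        by (rule mirror_image_comp[OF hom])
      moreover have "(shift d \<circ> n \<circ> (\<lambda>t. t - d)) \<circ> (\<lambda>t. (t - (h ^ 3 * k + k)) / u) = shift b"
        using nz \<open>d - u * d = b\<close> by (auto simp: n_def shift_def fun_eq_iff right_diff_distrib[of _ _ d])
      ultimately show ?thesis by simp
    qed
    \<comment> \<open>Removing the translation part of \<open>n\<close> leaves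
      \<open>scal u\<close>; its powers and the translations make up all affine maps.\<close>
    have "scal u = shift (- (h ^ 3 * k + k)) \<circ> n"
      by (simp add: scal_def n_def shift_def fun_eq_iff)
    then have scal_u: "scal u \<in> mirror_image \<phi>"
      using mirror_image_comp[OF hom shift_mem n] by simp
    have scal_mem: "scal (u ^ i) \<in> mirror_image \<phi>" for i
    proof (induction i)
      case 0
      have "scal (u ^ 0) = shift 0" by (simp add: scal_def shift_def)
      then show ?case using shift_mem by simp
    next
      case (Suc i)
      have "scal (u ^ Suc i) = scal u \<circ> scal (u ^ i)" by (simp add: scal_def fun_eq_iff mult.assoc)
      then show ?case using mirror_image_comp[OF hom scal_u Suc] by (simp only:)
    qed
    show "carrier AGL1 \<subseteq> mirror_image \<phi>"
    proof
      fix f :: "'a \<Rightarrow> 'a" assume "f \<in> carrier AGL1"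
      then obtain a b where ab: "a \<noteq> 0" "f = (\<lambda>t. a * t + b)" by (auto simp: AGL1_iff)
      obtain i where "a = u ^ i" using u[OF ab(1)] by blast
      then have "f = shift b \<circ> scal (u ^ i)" using ab(2) by (simp add: shift_def scal_def fun_eq_iff)
      then show "f \<in> mirror_image \<phi>" using mirror_image_comp[OF hom shift_mem scal_mem] by (simp only:)
    qed
  qed
  then have "(AGL1 :: ('a \<Rightarrow> 'a) monoid) = perm_group\<lparr>carrier := mirror_image \<phi>\<rparr>"
    by (simp add: AGL1_def perm_group_def)
  then have "(AGL1 :: ('a \<Rightarrow> 'a) monoid) \<cong> perm_group\<lparr>carrier := mirror_image \<phi>\<rparr>"
    using iso_refl by metis
  then show ?thesis
    using chirality_group_of_hom[OF hom group_AGL1] by (simp add: mirror_image_def)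
qed

theorem theorem26:
  fixes q :: nat
  assumes "primepow q"
    and "card (UNIV :: 'a::finite_field set) = q"
  shows "is_chirality_group (AGL1 :: ('a \<Rightarrow> 'a) monoid) \<longleftrightarrow> (\<exists>e. odd e \<and> q = 2 ^ e)"
proof
  assume "\<exists>e. odd e \<and> q = 2 ^ e"
  then obtain e where e: "odd e" "q = 2 ^ e" by blast
  show "is_chirality_group (AGL1 :: ('a \<Rightarrow> 'a) monoid)"
  proof (cases "e = 1")
    case True
    then show ?thesis using chirality_group_AGL1_2 assms(2) e(2) by simp
  next
    case False
    then show ?thesis using chirality_group_AGL1_power2 assms(2) e by simp
  qed
next
  assume chir: "is_chirality_group (AGL1 :: ('a \<Rightarrow> 'a) monoid)"
  obtain p k where pk: "Factorial_Ring.prime p" "k > 0" "q = p ^ k"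
    using assms(1) by (auto simp: primepow_def)
  have n2: "\<not> 2 dvd q - 1" and n3: "\<not> 3 dvd q - 1"
    using not_chirality_group_AGL1[where 'a = 'a, of 2] not_chirality_group_AGL1[where 'a = 'a, of 3]
      chir assms(2) by auto
  have "even q" using n2 by presburger
  then have "even p" using pk by simp
  then have p: "p = 2" using primes_dvd_imp_eq[OF two_is_prime_nat pk(1)] by simp
  \<comment> \<open>An even exponent makes \<open>q\<close> a power of 4, hence 1 modulo 3, so that
    3 divides \<open>q - 1\<close>.\<close>
  have "odd k"
  proof
    assume "even k"
    then obtain j where "k = 2 * j" by blast
    then have "q = 4 ^ j" using pk(3) p by (simp add: power_mult)
    have "(4 :: nat) ^ j mod 3 = 1" by (simp add: power_mod[symmetric])
    then show False using n3 \<open>q = 4 ^ j\<close> by presburger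
  qed
  then show "\<exists>e. odd e \<and> q = 2 ^ e" using pk p by blast
qed

end
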